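(* Let $M\in\mathbb{C}^{n\times n}$ be a positive-definite matrix (not necessarily Hermitian) and $\bm{b}\in\mathbb{C}^n$ a nonzero vector. Let $k\ge1$ be such that $Q_k$ and $H_k$ of the Arnoldi process for $M$ and $\bm{b}$ are defined, and let $\lambda_1(H_k),\dots,\lambda_k(H_k)$ be the eigenvalues of $H_k$ (counted with algebraic multiplicity). Then $$\|M^{1/2}\bm{b}-\operatorname{Arn}_k(x^{1/2};M,\bm{b})\|\le\frac{1}{\pi}\left(\int_0^\infty x^{1/2}\prod_{i=1}^k\left|\frac{\lambda_i(H_k)}{\lambda_i(H_k)+x}\right|\,\mathrm{d}x\right)\|\bm{\xi}_0^k\|,$$ where the integral is understood as an element of $[0,\infty]$ (with the convention $\infty\cdot 0=0$ on the right-hand side).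
   Context: $\|\cdot\|$ is the Euclidean norm. A matrix $M\in\mathbb{C}^{n\times n}$ is called positive-definite if $\operatorname{Re}(\bm{x}^*M\bm{x})>0$ for every unit vector $\bm{x}\in\mathbb{C}^n$ ($M$ need not be Hermitian). For such $M$, $M^{1/2}$ denotes its unique positive-definite square root, i.e. the principal square root (the matrix function of $x^{1/2}$ with the principal branch, branch cut along the negative real axis). $H_k=Q_k^*MQ_k$ below is then also positive-definite, and $H_k^{1/2}$ is defined in the same way. Arnoldi process: given $M$ and $\bm{b}\neq \bm 0$, set $\bm{q}_1=\bm{b}/\|\bm{b}\|$. For $j=1,2,\dots,k$: start with $\bm{w}=M\bm{q}_j$; for $i=1,\dots,j$ successively put $h_{i,j}=\bm{q}_i^*\bm{w}$ and replace $\bm{w}$ by $\bm{w}-h_{i,j}\bm{q}_i$; then put $h_{j+1,j}=\|\bm{w}\|$, stop if $h_{j+1,j}=0$, and otherwise put $\bm{q}_{j+1}=\bm{w}/h_{j+1,j}$. It is understood that the process does not stop before step $k$ (i.e. $h_{j+1,j}\ne0$ for $1\le j<k$). Then $Q_k=[\bm{q}_1,\dots,\bm{q}_k]$ has orthonormal columns, $H_k=[h_{i,j}]_{i,j=1}^k$ is upper Hessenberg (with $h_{i,j}=0$ for $i>j+1$), and $H_k=Q_k^*MQ_k$. $\operatorname{Arn}_k(x^{1/2};M,\bm{b}):=Q_kH_k^{1/2}Q_k^*\bm{b}=\|\bm{b}\|Q_kH_k^{1/2}\bm{e}_1$, with $\bm{e}_1$ the first canonical basis vector of $\mathbb{C}^k$.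 $\bm{\xi}_0^k:=M^{-1}\bm{b}-Q_kH_k^{-1}\|\bm{b}\|\bm{e}_1$ is the error of the $k$-th iterate of the Full Orthogonalization Method (zero initial guess) for $M\bm{x}=\bm{b}$. *)

theory Defs
  imports
    "HOL-Analysis.Analysis"
    "Jordan_Normal_Form.Schur_Decomposition"
    "Jordan_Normal_Form.Gauss_Jordan_Elimination"
begin

unbundle no vec_syntax
no_notation inner (infix "\<bullet>" 70)

definition vnorm :: "complex vec \<Rightarrow> real" where
  "vnorm v = L2_set (\<lambda>i. cmod (v $ i)) {..<dim_vec v}"

text \<open>Note that \<open>v \<bullet>c w\<close> conjugates its \<^emph>\<open>second\<close> argument, so \<open>x\<^sup>* y\<close> is written \<open>y \<bullet>c x\<close>.\<close>

definition pos_def :: "complex mat \<Rightarrow> bool" where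
  "pos_def A \<longleftrightarrow> square_mat A \<and>
     (\<forall>x \<in> carrier_vec (dim_row A). vnorm x = 1 \<longrightarrow> Re ((A *\<^sub>v x) \<bullet>c x) > 0)"

text \<open>A positive-definite matrix has exactly one positive-definite square root, namely the
  principal one; \<open>mat_sqrt\<close> is meant for such arguments only.\<close>

definition mat_sqrt :: "complex mat \<Rightarrow> complex mat" where
  "mat_sqrt A = (THE S. S \<in> carrier_mat (dim_row A) (dim_row A) \<and> pos_def S \<and> S * S = A)"

text \<open>Likewise meant for invertible arguments only.\<close>

definition mat_inv :: "complex mat \<Rightarrow> complex mat" where
  "mat_inv A = the (mat_inverse A)"

text \<open>The inner loop of modified Gram--Schmidt: for each \<open>q\<close> in the list, from left to right,
  \<open>w\<close> is replaced by \<open>w - (q\<^sup>* w) q\<close>, where \<open>w\<close> is the current (already updated) vector.\<close>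

definition mgs :: "complex vec list \<Rightarrow> complex vec \<Rightarrow> complex vec" where
  "mgs qs w = fold (\<lambda>q w. w - (w \<bullet>c q) \<cdot>\<^sub>v q) qs w"

text \<open>\<open>arnoldi_vecs M b k\<close> is the list of \<open>q\<^sub>1, \<dots>, q\<^sub>k\<close>. List and matrix indices start
  at 0, so that \<open>arnoldi_vecs M b k ! j\<close> is \<open>q\<close> with index \<open>j + 1\<close>, and \<open>arnoldi_h M b i j\<close> is
  \<open>h\<close> with indices \<open>i + 1, j + 1\<close>. The stopping criterion is not part of the recursion (after a
  breakdown the values are meaningless); it is expressed by \<open>arnoldi_defined\<close>.\<close>

fun arnoldi_vecs :: "complex mat \<Rightarrow> complex vec \<Rightarrow> nat \<Rightarrow> complex vec list" where
  "arnoldi_vecs M b 0 = []"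
| "arnoldi_vecs M b (Suc 0) = [complex_of_real (1 / vnorm b) \<cdot>\<^sub>v b]"
| "arnoldi_vecs M b (Suc (Suc j)) =
     (let qs = arnoldi_vecs M b (Suc j);
          w = mgs qs (M *\<^sub>v (qs ! j))
      in qs @ [complex_of_real (1 / vnorm w) \<cdot>\<^sub>v w])"

definition arnoldi_h :: "complex mat \<Rightarrow> complex vec \<Rightarrow> nat \<Rightarrow> nat \<Rightarrow> complex" where
  "arnoldi_h M b i j =
     (let qs = arnoldi_vecs M b (Suc j);
          w = mgs (take i qs) (M *\<^sub>v (qs ! j))
      in if i \<le> j then w \<bullet>c (qs ! i)
         else if i = Suc j then complex_of_real (vnorm w)
         else 0)"

definition arnoldi_defined :: "complex mat \<Rightarrow> complex vec \<Rightarrow> nat \<Rightarrow> bool" where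
  "arnoldi_defined M b k \<longleftrightarrow> (\<forall>j. Suc j < k \<longrightarrow> arnoldi_h M b (Suc j) j \<noteq> 0)"

definition arnoldi_Q :: "complex mat \<Rightarrow> complex vec \<Rightarrow> nat \<Rightarrow> complex mat" where
  "arnoldi_Q M b k = mat_of_cols (dim_row M) (arnoldi_vecs M b k)"

definition arnoldi_H :: "complex mat \<Rightarrow> complex vec \<Rightarrow> nat \<Rightarrow> complex mat" where
  "arnoldi_H M b k = mat k k (\<lambda>(i, j). arnoldi_h M b i j)"

definition arn_sqrt :: "nat \<Rightarrow> complex mat \<Rightarrow> complex vec \<Rightarrow> complex vec" where
  "arn_sqrt k M b =
     arnoldi_Q M b k *\<^sub>v (mat_sqrt (arnoldi_H M b k) *\<^sub>v (mat_adjoint (arnoldi_Q M b k) *\<^sub>v b))"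

definition fom_error :: "nat \<Rightarrow> complex mat \<Rightarrow> complex vec \<Rightarrow> complex vec" where
  "fom_error k M b =
     mat_inv M *\<^sub>v b -
     arnoldi_Q M b k *\<^sub>v (mat_inv (arnoldi_H M b k) *\<^sub>v (complex_of_real (vnorm b) \<cdot>\<^sub>v unit_vec k 0))"

end

theory Submission
  imports Defs "HOL-Complex_Analysis.Cauchy_Integral_Theorem"
begin

unbundle no vec_syntax
no_notation inner (infix "\<bullet>" 70)

text \<open>
  For a positive-definite \<open>A\<close> one has \<open>\<pi> A\<^sup>1\<^sup>/\<^sup>2 b = \<integral>\<^sub>0\<^sup>\<infinity> 2 A (A + s\<^sup>2 I)\<^sup>-\<^sup>1 b ds\<close>, because
  \<open>2 A (A + s\<^sup>2 I)\<^sup>-\<^sup>1 = S (S + i s I)\<^sup>-\<^sup>1 + S (S - i s I)\<^sup>-\<^sup>1\<close> for \<open>S\<^sup>2 = A\<close>, and the resolvent of \<open>S\<close> is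
  holomorphic on the closed right half-plane and behaves like \<open>1/w\<close> at infinity. The formula
  determines \<open>S\<close>, so the square root is unique; it exists because \<open>I - \<epsilon> A\<close> is a strict contraction
  for small \<open>\<epsilon>\<close>. Since \<open>A (A + s\<^sup>2 I)\<^sup>-\<^sup>1 = I - s\<^sup>2 (A + s\<^sup>2 I)\<^sup>-\<^sup>1\<close>, subtracting the formulas for \<open>M\<close> and
  \<open>H\<^sub>k\<close> expresses the Arnoldi error through the errors \<open>\<xi>\<^sub>t\<close> of the Full Orthogonalization Method for
  \<open>M + t I\<close>, \<open>t = s\<^sup>2\<close>. By Cramer's rule for the Hessenberg matrix \<open>H\<^sub>k + t I\<close>, the residual
  \<open>(M + t I) \<xi>\<^sub>t\<close> is \<open>\<Prod>\<^sub>i \<lambda>\<^sub>i / (\<lambda>\<^sub>i + t)\<close> times \<open>M \<xi>\<^sub>0\<close>, and \<open>(M + t I)\<^sup>-\<^sup>1 M\<close> is a contraction.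
\<close>

section \<open>Norm and coercivity\<close>

lemma cscalar_prod_sum:
  fixes x y :: "complex vec"
  assumes "x \<in> carrier_vec n" "y \<in> carrier_vec n"
  shows "x \<bullet>c y = (\<Sum>i<n. x $ i * cnj (y $ i))"
  using assms unfolding scalar_prod_def by (auto intro!: sum.cong simp: lessThan_atLeast0)

lemma vnorm_carrier: "x \<in> carrier_vec n \<Longrightarrow> vnorm x = L2_set (\<lambda>i. cmod (x $ i)) {..<n}"
  unfolding vnorm_def by auto

lemma vnorm_nonneg [simp]: "0 \<le> vnorm x"
  unfolding vnorm_def by simp

lemma cscalar_prod_self:
  assumes "x \<in> carrier_vec n"
  shows "x \<bullet>c x = complex_of_real ((vnorm x)\<^sup>2)"
proof -
  have "(vnorm x)\<^sup>2 = (\<Sum>i<n. (cmod (x $ i))\<^sup>2)"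
    unfolding vnorm_carrier[OF assms] L2_set_def by (simp add: sum_nonneg)
  then show ?thesis
    using assms by (simp add: cscalar_prod_sum[of _ n] complex_norm_square[symmetric])
qed

lemma cscalar_prod_cnj:
  fixes x y :: "complex vec"
  assumes "x \<in> carrier_vec n" "y \<in> carrier_vec n"
  shows "y \<bullet>c x = cnj (x \<bullet>c y)"
  using assms by (simp add: cscalar_prod_sum[of _ n] mult.commute)

lemma vnorm_eq_0_iff: "x \<in> carrier_vec n \<Longrightarrow> vnorm x = 0 \<longleftrightarrow> x = 0\<^sub>v n"
  unfolding vnorm_carrier by (auto simp: L2_set_eq_0_iff)

lemma vnorm_zero [simp]: "vnorm (0\<^sub>v n) = 0"
  by (simp add: vnorm_def L2_set_def)

lemma cscalar_prod_le:
  fixes x y :: "complex vec"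
  assumes "x \<in> carrier_vec n" "y \<in> carrier_vec n"
  shows "cmod (x \<bullet>c y) \<le> vnorm x * vnorm y"
proof -
  have "cmod (x \<bullet>c y) \<le> (\<Sum>i<n. cmod (x $ i) * cmod (y $ i))"
    using assms by (auto simp: cscalar_prod_sum[of _ n] norm_mult intro!: order.trans[OF norm_sum])
  also have "\<dots> \<le> vnorm x * vnorm y"
    using L2_set_mult_ineq[of "\<lambda>i. cmod (x $ i)" "\<lambda>i. cmod (y $ i)" "{..<n}"] assms
    by (simp add: vnorm_carrier[of _ n])
  finally show ?thesis .
qed

lemma vnorm_add_le:
  assumes "x \<in> carrier_vec n" "y \<in> carrier_vec n"
  shows "vnorm (x + y) \<le> vnorm x + vnorm y"
proof -
  have "vnorm (x + y) \<le> L2_set (\<lambda>i. cmod (x $ i) + cmod (y $ i)) {..<n}"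
    using assms by (auto simp: vnorm_carrier[of _ n] intro!: L2_set_mono norm_triangle_ineq)
  also have "\<dots> \<le> vnorm x + vnorm y"
    using assms by (simp add: vnorm_carrier[of _ n] L2_set_triangle_ineq)
  finally show ?thesis .
qed

lemma vnorm_smult: "vnorm (a \<cdot>\<^sub>v x) = cmod a * vnorm x"
proof -
  have "vnorm (a \<cdot>\<^sub>v x) = L2_set (\<lambda>i. cmod a * cmod (x $ i)) {..<dim_vec x}"
    by (auto simp: vnorm_def norm_mult intro!: L2_set_cong)
  then show ?thesis by (simp add: vnorm_def L2_set_right_distrib)
qed

lemma vnorm_minus_le:
  assumes "x \<in> carrier_vec n" "y \<in> carrier_vec n"
  shows "vnorm (x - y) \<le> vnorm x + vnorm y"
proof -
  have "x - y = x + (-1) \<cdot>\<^sub>v y" using assms by auto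
  then show ?thesis using vnorm_add_le[of x n "(-1) \<cdot>\<^sub>v y"] assms vnorm_smult[of "-1" y] by auto
qed

lemma cmod_index_le_vnorm:
  assumes "x \<in> carrier_vec n" "i < n"
  shows "cmod (x $ i) \<le> vnorm x"
  using member_le_L2_set[of "{..<n}" i "\<lambda>i. cmod (x $ i)"] assms by (simp add: vnorm_carrier)

lemma vnorm_le_sum:
  assumes "x \<in> carrier_vec n"
  shows "vnorm x \<le> (\<Sum>i<n. cmod (x $ i))"
  using assms by (simp add: vnorm_carrier[of _ n] L2_set_le_sum)

lemma mult_mat_vec_index:
  assumes "A \<in> carrier_mat m n" "x \<in> carrier_vec n" "i < m"
  shows "(A *\<^sub>v x) $ i = (\<Sum>j<n. A $$ (i, j) * x $ j)"
  using assms unfolding mult_mat_vec_def scalar_prod_def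
  by (auto intro!: sum.cong simp: lessThan_atLeast0)

lemma mat_vec_bounded:
  fixes A :: "complex mat"
  assumes A: "A \<in> carrier_mat m n"
  obtains K where "K \<ge> 0" "\<And>x. x \<in> carrier_vec n \<Longrightarrow> vnorm (A *\<^sub>v x) \<le> K * vnorm x"
proof
  define K where "K = (\<Sum>i<m. \<Sum>j<n. cmod (A $$ (i, j)))"
  show "K \<ge> 0" unfolding K_def by (intro sum_nonneg) auto
  fix x :: "complex vec" assume x: "x \<in> carrier_vec n"
  have "vnorm (A *\<^sub>v x) \<le> (\<Sum>i<m. cmod ((A *\<^sub>v x) $ i))"
    using A x by (intro vnorm_le_sum) auto
  also have "\<dots> \<le> (\<Sum>i<m. \<Sum>j<n. cmod (A $$ (i, j)) * vnorm x)"
    using A x cmod_index_le_vnorm[OF x]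
    by (intro sum_mono) (auto simp: mult_mat_vec_index norm_mult simp del: index_mult_mat_vec
      intro!: order.trans[OF norm_sum] sum_mono mult_left_mono)
  also have "\<dots> = K * vnorm x" by (simp add: K_def sum_distrib_right)
  finally show "vnorm (A *\<^sub>v x) \<le> K * vnorm x" .
qed

text \<open>The unit sphere is modelled inside the function space, where Tychonoff's theorem gives
  compactness. Coordinates with index \<open>n\<close> or larger are free in the closed unit disc,
  which keeps the set compact.\<close>

lemma compact_sphere_fun:
  "compact {f :: nat \<Rightarrow> complex. (\<forall>i. cmod (f i) \<le> 1) \<and> (\<Sum>i<n. (cmod (f i))\<^sup>2) = 1}"
proof -
  have "compactin (product_topology (\<lambda>i. euclidean) UNIV) (PiE UNIV (\<lambda>i::nat. cball (0::complex) 1))"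
    by (subst compactin_PiE) auto
  then have 1: "compact (PiE UNIV (\<lambda>i::nat. cball (0::complex) 1))"
    by (simp add: euclidean_product_topology)
  have 2: "closed {f :: nat \<Rightarrow> complex. (\<Sum>i<n. (cmod (f i))\<^sup>2) = 1}"
    by (intro closed_Collect_eq continuous_intros continuous_on_product_coordinates)
  have "{f :: nat \<Rightarrow> complex. (\<forall>i. cmod (f i) \<le> 1) \<and> (\<Sum>i<n. (cmod (f i))\<^sup>2) = 1}
    = PiE UNIV (\<lambda>i. cball 0 1) \<inter> {f. (\<Sum>i<n. (cmod (f i))\<^sup>2) = 1}" by auto
  then show ?thesis using compact_Int_closed[OF 1 2] by simp
qed

text \<open>By compactness the continuous quadratic form attains a positive minimum \<open>d\<close>
  on the unit sphere, and homogeneity carries the bound to all vectors. This uniform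
  \<open>d\<close> is what every later use of positive-definiteness relies on.\<close>

lemma pos_def_coercive:
  assumes A: "A \<in> carrier_mat n n" and pd: "pos_def A"
  obtains d where "d > 0" "\<And>x. x \<in> carrier_vec n \<Longrightarrow> d * (vnorm x)\<^sup>2 \<le> Re ((A *\<^sub>v x) \<bullet>c x)"
proof -
  define S where "S = {f :: nat \<Rightarrow> complex. (\<forall>i. cmod (f i) \<le> 1) \<and> (\<Sum>i<n. (cmod (f i))\<^sup>2) = 1}"
  define q where "q f = Re (\<Sum>i<n. (\<Sum>j<n. A $$ (i, j) * f j) * cnj (f i))" for f :: "nat \<Rightarrow> complex"
  have q_vec: "q (\<lambda>i. x $ i) = Re ((A *\<^sub>v x) \<bullet>c x)" if "x \<in> carrier_vec n" for x
    using A that by (simp add: q_def cscalar_prod_sum[of _ n] mult_mat_vec_index[OF A] del: index_mult_mat_vec)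
  have q_cong: "q f = q g" if "\<And>i. i < n \<Longrightarrow> f i = g i" for f g
    using that unfolding q_def by (auto intro!: sum.cong arg_cong[of _ _ Re])
  have "\<exists>d>0. \<forall>f\<in>S. d \<le> q f"
  \<comment> \<open>The sphere is empty exactly for \<open>n = 0\<close>; any positive
    \<open>d\<close> then serves.\<close>
  proof (cases "S = {}")
    case False
    have "continuous_on S q" unfolding q_def
      by (intro continuous_intros continuous_on_product_coordinates continuous_on_subset[OF continuous_on_product_coordinates]) auto
    from continuous_attains_inf[OF _ False this] compact_sphere_fun[of n]
    obtain f where f: "f \<in> S" "\<forall>g\<in>S. q f \<le> q g" by (auto simp: S_def)
    define x where "x = vec n f"
    have "vnorm x = 1" using f(1) by (simp add: x_def vnorm_def L2_set_def S_def)
    then have "q (\<lambda>i. x $ i) > 0"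
      using pd A q_vec[of x] by (auto simp: pos_def_def x_def)
    moreover have "q (\<lambda>i. x $ i) = q f" by (intro q_cong) (simp add: x_def)
    ultimately show ?thesis using f(2) by auto
  qed (auto intro: exI[of _ 1])
  then obtain d where d: "d > 0" "\<And>f. f \<in> S \<Longrightarrow> d \<le> q f" by auto
  show ?thesis
  proof
    fix x :: "complex vec" assume x: "x \<in> carrier_vec n"
    show "d * (vnorm x)\<^sup>2 \<le> Re ((A *\<^sub>v x) \<bullet>c x)"
    proof (cases "vnorm x = 0")
      case True
      then show ?thesis using x A cscalar_prod_sum[of "A *\<^sub>v 0\<^sub>v n" n "0\<^sub>v n"] by (auto simp: vnorm_eq_0_iff)
    next
      case False
      define r where "r = vnorm x"
      have r: "r > 0" using False by (simp add: r_def order_less_le)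
      \<comment> \<open>The normalized vector is padded by zeros so that it satisfies the bound on
        all coordinates required in \<open>S\<close>.\<close>
      define f where "f i = (if i < n then x $ i / r else 0)" for i
      have "cmod (f i) \<le> 1" for i
        using cmod_index_le_vnorm[OF x, of i] r by (auto simp: f_def norm_divide r_def)
      moreover have "(\<Sum>i<n. (cmod (f i))\<^sup>2) = 1"
      proof -
        have "(\<Sum>i<n. (cmod (f i))\<^sup>2) = (\<Sum>i<n. (cmod (x $ i))\<^sup>2) / r\<^sup>2"
          by (simp add: f_def norm_divide power_divide sum_divide_distrib)
        also have "(\<Sum>i<n. (cmod (x $ i))\<^sup>2) = r\<^sup>2"
          unfolding r_def vnorm_carrier[OF x] L2_set_def by (simp add: sum_nonneg)
        finally show ?thesis using r by simp
      qed
      ultimately have "d \<le> q f" using d(2) by (auto simp: S_def)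
      also have "q f = q (\<lambda>i. x $ i) / r\<^sup>2"
      proof -
        have "(\<Sum>i<n. (\<Sum>j<n. A $$ (i, j) * f j) * cnj (f i)) =
          (\<Sum>i<n. (\<Sum>j<n. A $$ (i, j) * x $ j) * cnj (x $ i)) / complex_of_real (r\<^sup>2)"
          by (simp add: f_def sum_divide_distrib sum_distrib_right power2_eq_square)
        then show ?thesis by (simp add: q_def Re_divide_of_real del: of_real_power)
      qed
      finally show ?thesis using r q_vec[OF x] by (simp add: field_simps r_def)
    qed
  qed (rule d(1))
qed

section \<open>Existence of the square root\<close>

text \<open>An upper bound for the operator norm, kept as a relation so that no supremum has to be
  formed.\<close>

definition op_le :: "nat \<Rightarrow> complex mat \<Rightarrow> real \<Rightarrow> bool" where
  "op_le n A c \<longleftrightarrow> (\<forall>x \<in> carrier_vec n. vnorm (A *\<^sub>v x) \<le> c * vnorm x)"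

lemma op_leD: "op_le n A c \<Longrightarrow> x \<in> carrier_vec n \<Longrightarrow> vnorm (A *\<^sub>v x) \<le> c * vnorm x"
  unfolding op_le_def by auto

lemma op_le_mono: "op_le n A c \<Longrightarrow> c \<le> d \<Longrightarrow> op_le n A d"
  unfolding op_le_def using mult_right_mono[OF _ vnorm_nonneg] order.trans by blast

lemma op_le_add:
  assumes "A \<in> carrier_mat n n" "B \<in> carrier_mat n n" "op_le n A c" "op_le n B d"
  shows "op_le n (A + B) (c + d)"
  unfolding op_le_def
proof
  fix x :: "complex vec" assume x: "x \<in> carrier_vec n"
  have "vnorm ((A + B) *\<^sub>v x) \<le> vnorm (A *\<^sub>v x) + vnorm (B *\<^sub>v x)"
    using assms x vnorm_add_le[of "A *\<^sub>v x" n "B *\<^sub>v x"]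
    by (simp add: add_mult_distrib_mat_vec[of _ n n])
  then show "vnorm ((A + B) *\<^sub>v x) \<le> (c + d) * vnorm x"
    using op_leD[OF assms(3) x] op_leD[OF assms(4) x] by (simp add: algebra_simps)
qed

lemma op_le_mult:
  assumes "A \<in> carrier_mat n n" "B \<in> carrier_mat n n" "op_le n A c" "op_le n B d" "c \<ge> 0"
  shows "op_le n (A * B) (c * d)"
  unfolding op_le_def
proof
  fix x :: "complex vec" assume x: "x \<in> carrier_vec n"
  have "vnorm ((A * B) *\<^sub>v x) \<le> c * vnorm (B *\<^sub>v x)"
    using assms x op_leD[OF assms(3), of "B *\<^sub>v x"] by (simp add: assoc_mult_mat_vec[of _ n n])
  also have "\<dots> \<le> c * (d * vnorm x)"
    using op_leD[OF assms(4) x] assms(5) by (intro mult_left_mono)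
  finally show "vnorm ((A * B) *\<^sub>v x) \<le> (c * d) * vnorm x" by (simp add: mult.assoc)
qed

lemma smult_mat_mult_vec:
  assumes "A \<in> carrier_mat m n" "x \<in> carrier_vec n"
  shows "(a \<cdot>\<^sub>m A) *\<^sub>v x = (a :: complex) \<cdot>\<^sub>v (A *\<^sub>v x)"
  using assms
  by (intro eq_vecI) (auto simp: mult_mat_vec_index[of _ m n] sum_distrib_left mult.assoc simp del: index_mult_mat_vec)

lemma op_le_smult:
  assumes "A \<in> carrier_mat n n" "op_le n A c"
  shows "op_le n (a \<cdot>\<^sub>m A) (cmod a * c)"
  unfolding op_le_def
  using op_leD[OF assms(2)] assms(1) by (simp add: smult_mat_mult_vec vnorm_smult mult_left_mono mult.assoc)

text \<open>The entry is a coordinate of \<open>A\<close> applied to a unit vector. This turns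
  operator bounds into entrywise convergence.\<close>

lemma op_le_entry:
  assumes "A \<in> carrier_mat n n" "op_le n A c" "i < n" "j < n"
  shows "cmod (A $$ (i, j)) \<le> c"
proof -
  have "vnorm (unit_vec n j) = 1"
  proof -
    have "(\<Sum>i<n. (cmod (unit_vec n j $ i))\<^sup>2) = (\<Sum>i<n. if i = j then 1 else 0)"
      by (intro sum.cong) (auto simp: unit_vec_def)
    then show ?thesis using assms(4) by (simp add: vnorm_def L2_set_def)
  qed
  moreover have "(A *\<^sub>v unit_vec n j) $ i = A $$ (i, j)"
    using assms(1,3,4) by simp
  ultimately show ?thesis
    using cmod_index_le_vnorm[of "A *\<^sub>v unit_vec n j" n i] op_leD[OF assms(2), of "unit_vec n j"] assms by auto
qed

lemma mult_mat_index:
  assumes "A \<in> carrier_mat m n" "B \<in> carrier_mat n l" "i < m" "j < l"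
  shows "(A * B) $$ (i, j) = (\<Sum>k<n. A $$ (i, k) * B $$ (k, j))"
  using assms by (auto simp: scalar_prod_def lessThan_atLeast0 intro!: sum.cong)

text \<open>Picard iteration for \<open>Y = (C + Y\<^sup>2) / 2\<close>, a contraction on the ball of radius \<open>c\<close>.\<close>

lemma quadratic_fixed_point:
  assumes C: "C \<in> carrier_mat n n" and op: "op_le n C c" and c: "0 \<le> c" "c < 1"
  obtains Y where "Y \<in> carrier_mat n n" "op_le n Y c" "Y + Y = C + Y * Y"
proof -
  define Y where "Y m = ((\<lambda>Y. (1/2) \<cdot>\<^sub>m (C + Y * Y)) ^^ m) (0\<^sub>m n n)" for m
  have Y0: "Y 0 = 0\<^sub>m n n" and YS: "Y (Suc m) = (1/2) \<cdot>\<^sub>m (C + Y m * Y m)" for m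
    by (simp_all add: Y_def)
  have Yc: "Y m \<in> carrier_mat n n" for m
    by (induction m) (use C in \<open>auto simp: Y0 YS\<close>)
  have opY: "op_le n (Y m) c" for m
  proof (induction m)
    case 0
    have "0\<^sub>m n n *\<^sub>v x = 0\<^sub>v n" if "x \<in> carrier_vec n" for x :: "complex vec"
      using that by (intro eq_vecI) auto
    then show ?case using c by (auto simp: op_le_def Y0)
  next
    case (Suc m)
    have "op_le n (Y (Suc m)) (cmod (1/2) * (c + c * c))"
      unfolding YS using C Yc Suc op c mult_carrier_mat[OF Yc Yc] by (intro op_le_smult op_le_add op_le_mult) auto
    \<comment> \<open>The ball of radius \<open>c\<close> is preserved because
      \<open>c * c \<le> c\<close> for \<open>0 \<le> c < 1\<close>.\<close>
    moreover have "cmod (1/2) * (c + c * c) \<le> c"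
      using mult_right_mono[of c 1 c] c by simp
    ultimately show ?case by (rule op_le_mono)
  qed
  have opD: "op_le n (Y (Suc m) - Y m) (c ^ m)" for m
  proof (induction m)
    case 0
    have "op_le n (Y (Suc 0)) 1" using op_le_mono[OF opY] c by simp
    moreover have "Y (Suc 0) - Y 0 = Y (Suc 0)" using Yc[of "Suc 0"] by (auto simp: Y0)
    ultimately show ?case by simp
  next
    case (Suc m)
    let ?A = "Y (Suc m)" and ?B = "Y m"
    \<comment> \<open>Noncommutative factorization of the difference of two squares. With both
      iterates bounded by \<open>c\<close>, halving leaves the factor
      \<open>(c + c) / 2 = c\<close>, so the increments decay geometrically.\<close>
    have "?A * (?A - ?B) + (?A - ?B) * ?B = ?A * ?A - ?A * ?B + (?A * ?B - ?B * ?B)"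
      using mult_minus_distrib_mat[OF Yc Yc Yc, of "Suc m" "Suc m" m]
        minus_mult_distrib_mat[OF Yc Yc Yc, of "Suc m" m m] by simp
    also have "\<dots> = (C + ?A * ?A) - (C + ?B * ?B)"
      using Yc[of m] Yc[of "Suc m"] C by (intro eq_matI) (auto simp del: index_mult_mat(1))
    finally have "Y (Suc (Suc m)) - ?A = (1/2) \<cdot>\<^sub>m (?A * (?A - ?B) + (?A - ?B) * ?B)"
      unfolding YS[of "Suc m"] using Yc[of m] Yc[of "Suc m"] C
      by (subst YS[of m]) (intro eq_matI, auto simp del: index_mult_mat(1) simp: field_simps)
    moreover have "op_le n ((1/2) \<cdot>\<^sub>m (?A * (?A - ?B) + (?A - ?B) * ?B)) (cmod (1/2) * (c * c ^ m + c ^ m * c))"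
      using Yc[of m] Yc[of "Suc m"] opY[of m] opY[of "Suc m"] Suc c
      by (intro op_le_smult op_le_add op_le_mult) auto
    ultimately show ?case by (simp add: mult.commute)
  qed
  have conv: "convergent (\<lambda>m. Y m $$ (i, j))" if ij: "i < n" "j < n" for i j
  proof -
    have *: "cmod (Y (Suc m) $$ (i, j) - Y m $$ (i, j)) \<le> c ^ m" for m
      using op_le_entry[OF minus_carrier_mat[OF Yc] opD ij, of m] Yc[of m] Yc[of "Suc m"] ij by auto
    have "summable (\<lambda>m. Y (Suc m) $$ (i, j) - Y m $$ (i, j))"
      by (rule summable_comparison_test[OF _ summable_geometric[of c]]) (use * c in auto)
    then have "convergent (\<lambda>m. \<Sum>k<m. Y (Suc k) $$ (i, j) - Y k $$ (i, j))"
      by (simp add: summable_iff_convergent)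
    then have "convergent (\<lambda>m. Y m $$ (i, j) - Y 0 $$ (i, j))"
      using sum_lessThan_telescope[of "\<lambda>m. Y m $$ (i, j)"] by simp
    then show ?thesis
      using convergent_add[OF _ convergent_const[of "Y 0 $$ (i, j)"]] by fastforce
  qed
  define Z where "Z = mat n n (\<lambda>(i, j). lim (\<lambda>m. Y m $$ (i, j)))"
  have Zc: "Z \<in> carrier_mat n n" by (simp add: Z_def)
  have lim: "(\<lambda>m. Y m $$ (i, j)) \<longlonglongrightarrow> Z $$ (i, j)" if "i < n" "j < n" for i j
    using conv[OF that] that by (simp add: Z_def convergent_LIMSEQ_iff)
  have "op_le n Z c" unfolding op_le_def
  proof
    fix x :: "complex vec" assume x: "x \<in> carrier_vec n"
    have "(\<lambda>m. vnorm (Y m *\<^sub>v x)) \<longlonglongrightarrow> vnorm (Z *\<^sub>v x)"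
    proof -
      have "(\<lambda>m. sqrt (\<Sum>i<n. (cmod (\<Sum>j<n. Y m $$ (i, j) * x $ j))\<^sup>2))
        \<longlonglongrightarrow> sqrt (\<Sum>i<n. (cmod (\<Sum>j<n. Z $$ (i, j) * x $ j))\<^sup>2)"
        by (intro tendsto_intros lim) auto
      moreover have "vnorm (A *\<^sub>v x) = sqrt (\<Sum>i<n. (cmod (\<Sum>j<n. A $$ (i, j) * x $ j))\<^sup>2)"
        if "A \<in> carrier_mat n n" for A
        using that x by (simp add: vnorm_carrier[of _ n] L2_set_def mult_mat_vec_index[of _ n n] del: index_mult_mat_vec)
      ultimately show ?thesis using Yc Zc by simp
    qed
    then show "vnorm (Z *\<^sub>v x) \<le> c * vnorm x"
      by (rule LIMSEQ_le_const2) (use op_leD[OF opY x] in auto)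
  qed
  moreover have "Z + Z = C + Z * Z"
  proof (rule eq_matI)
    fix i j assume "i < dim_row (C + Z * Z)" "j < dim_col (C + Z * Z)"
    then have ij: "i < n" "j < n" using Zc by auto
    have "(\<lambda>m. (1/2) * (C $$ (i, j) + (\<Sum>k<n. Y m $$ (i, k) * Y m $$ (k, j))))
      \<longlonglongrightarrow> (1/2) * (C $$ (i, j) + (\<Sum>k<n. Z $$ (i, k) * Z $$ (k, j)))"
      by (intro tendsto_intros lim) (use ij in auto)
    moreover have "(1/2) * (C $$ (i, j) + (\<Sum>k<n. Y m $$ (i, k) * Y m $$ (k, j))) = Y (Suc m) $$ (i, j)" for m
      using ij Yc[of m] C by (simp add: YS mult_mat_index[of _ n n _ n] del: index_mult_mat(1))
    moreover have "(\<lambda>m. Y (Suc m) $$ (i, j)) \<longlonglongrightarrow> Z $$ (i, j)"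
      using lim[OF ij] by (rule LIMSEQ_Suc)
    ultimately have "(1/2) * (C $$ (i, j) + (\<Sum>k<n. Z $$ (i, k) * Z $$ (k, j))) = Z $$ (i, j)"
      using LIMSEQ_unique by fastforce
    then show "(Z + Z) $$ (i, j) = (C + Z * Z) $$ (i, j)"
      using ij Zc C by (simp add: mult_mat_index[of _ n n _ n] del: index_mult_mat(1))
  qed (use Zc C in auto)
  ultimately show ?thesis using that Zc by blast
qed

lemma Re_cscalar_prod_le:
  fixes x y :: "complex vec"
  assumes "x \<in> carrier_vec n" "y \<in> carrier_vec n"
  shows "Re (x \<bullet>c y) \<le> vnorm x * vnorm y"
  using cscalar_prod_le[OF assms] complex_Re_le_cmod order.trans by blast

text \<open>Take \<open>S = I - Y\<close> for the fixed point \<open>Y\<close>: then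
  \<open>S * S = I - (Y + Y) + Y * Y = I - C\<close>, and the real part of the quadratic form of
  \<open>S\<close> on unit vectors is at least \<open>1 - c\<close>.\<close>

lemma contraction_sqrt:
  assumes C: "C \<in> carrier_mat n n" and op: "op_le n C c" and c: "0 \<le> c" "c < 1"
  obtains S where "S \<in> carrier_mat n n" "pos_def S" "S * S = 1\<^sub>m n - C"
proof -
  obtain Y where Y: "Y \<in> carrier_mat n n" "op_le n Y c" "Y + Y = C + Y * Y"
    using quadratic_fixed_point[OF assms] by blast
  define S where "S = 1\<^sub>m n - Y"
  have Sc: "S \<in> carrier_mat n n" using Y by (simp add: S_def minus_carrier_mat)
  have "S * S = 1\<^sub>m n - Y - (Y - Y * Y)"
    using minus_mult_distrib_mat[OF one_carrier_mat Y(1) Sc] Sc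
      mult_minus_distrib_mat[OF Y(1) one_carrier_mat Y(1)] Y(1) by (simp add: S_def)
  also have "\<dots> = 1\<^sub>m n - C"
  proof (rule eq_matI)
    fix i j assume "i < dim_row (1\<^sub>m n - C)" "j < dim_col (1\<^sub>m n - C)"
    then have ij: "i < n" "j < n" using C by auto
    have "(Y + Y) $$ (i, j) = (C + Y * Y) $$ (i, j)" using Y(3) by simp
    then show "(1\<^sub>m n - Y - (Y - Y * Y)) $$ (i, j) = (1\<^sub>m n - C) $$ (i, j)"
      using ij Y(1) C by (simp del: index_mult_mat(1) add: algebra_simps)
  qed (use Y(1) C in auto)
  finally have 1: "S * S = 1\<^sub>m n - C" .
  have "pos_def S" unfolding pos_def_def
  proof (intro conjI ballI impI)
    fix x :: "complex vec" assume "x \<in> carrier_vec (dim_row S)" and v: "vnorm x = 1"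
    then have x: "x \<in> carrier_vec n" using Sc by auto
    have "S *\<^sub>v x = x - Y *\<^sub>v x"
      using x Y(1) by (simp add: S_def minus_mult_distrib_mat_vec[of _ n n])
    then have "(S *\<^sub>v x) \<bullet>c x = x \<bullet>c x - (Y *\<^sub>v x) \<bullet>c x"
      using x Y(1) by (simp add: minus_scalar_prod_distrib[of _ n])
    moreover have "Re ((Y *\<^sub>v x) \<bullet>c x) \<le> c"
      using Re_cscalar_prod_le[of "Y *\<^sub>v x" n x] op_leD[OF Y(2) x] x Y(1) v by simp
    ultimately show "0 < Re ((S *\<^sub>v x) \<bullet>c x)"
      using c v cscalar_prod_self[OF x] by simp
  qed (use Sc in auto)
  then show ?thesis using that Sc 1 by blast
qed

lemma pos_def_smult:
  assumes "A \<in> carrier_mat n n" "pos_def A" "r > 0"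
  shows "pos_def (complex_of_real r \<cdot>\<^sub>m A)"
  using assms unfolding pos_def_def by (auto simp: smult_mat_mult_vec[of _ n n])

lemma vnorm_minus_sq:
  assumes "x \<in> carrier_vec n" "y \<in> carrier_vec n"
  shows "(vnorm (x - y))\<^sup>2 = (vnorm x)\<^sup>2 - 2 * Re (y \<bullet>c x) + (vnorm y)\<^sup>2"
proof -
  have sq: "(vnorm z)\<^sup>2 = Re (z \<bullet>c z)" if "z \<in> carrier_vec n" for z
    using cscalar_prod_self[OF that] by simp
  have "Re (x \<bullet>c y) = Re (y \<bullet>c x)" using cscalar_prod_cnj[OF assms] by simp
  moreover have "(x - y) \<bullet>c (x - y) = x \<bullet>c x - x \<bullet>c y - y \<bullet>c x + y \<bullet>c y"
    using assms by (simp add: cscalar_prod_sum[of _ n] sum_subtractf sum.distrib algebra_simps)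
  ultimately show ?thesis using assms by (simp add: sq)
qed

text \<open>For small \<open>e\<close> the matrix \<open>C = I - e A\<close> is a strict
  contraction, so \<open>I - C = e A\<close> has a positive-definite square root; dividing that root
  by \<open>sqrt e\<close> gives one of \<open>A\<close>.\<close>

lemma pos_def_sqrt_exists:
  assumes A: "A \<in> carrier_mat n n" and pd: "pos_def A"
  obtains S where "S \<in> carrier_mat n n" "pos_def S" "S * S = A"
proof -
  obtain d where d: "d > 0" "\<And>x. x \<in> carrier_vec n \<Longrightarrow> d * (vnorm x)\<^sup>2 \<le> Re ((A *\<^sub>v x) \<bullet>c x)"
    using pos_def_coercive[OF assms] by blast
  obtain K where K: "K \<ge> 0" "\<And>x. x \<in> carrier_vec n \<Longrightarrow> vnorm (A *\<^sub>v x) \<le> K * vnorm x"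
    using mat_vec_bounded[OF A] by blast
  \<comment> \<open>The squared norm of \<open>C\<close> is at most
    \<open>1 - 2 e d + e (e K^2)\<close>. This choice yields \<open>e K^2 \<le> d\<close>, which
    leaves \<open>1 - e d\<close>, and the summand \<open>d^2\<close> in the denominator yields
    \<open>e d \<le> 1\<close>, so that the root in \<open>c\<close> is that of a nonnegative
    number.\<close>
  define e where "e = d / (K\<^sup>2 + d\<^sup>2)"
  have den: "K\<^sup>2 + d\<^sup>2 > 0" using d by (simp add: add_nonneg_pos)
  then have e: "e > 0" using d by (simp add: e_def)
  have e1: "e * K\<^sup>2 \<le> d" "e * d \<le> 1"
    using den d by (simp_all add: e_def field_simps power2_eq_square)
  define C where "C = 1\<^sub>m n - complex_of_real e \<cdot>\<^sub>m A"
  define c where "c = sqrt (1 - e * d)"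
  have c: "0 \<le> c" "c < 1" using e1 e d by (auto simp: c_def)
  have "op_le n C c" unfolding op_le_def
  proof
    fix x :: "complex vec" assume x: "x \<in> carrier_vec n"
    let ?y = "complex_of_real e \<cdot>\<^sub>v (A *\<^sub>v x)"
    have y: "?y \<in> carrier_vec n" using A x by auto
    have "C *\<^sub>v x = x - ?y"
      using A x by (simp add: C_def minus_mult_distrib_mat_vec[of _ n n] smult_mat_mult_vec[of _ n n])
    moreover have "?y \<bullet>c x = complex_of_real e * ((A *\<^sub>v x) \<bullet>c x)" using A x by simp
    ultimately have "(vnorm (C *\<^sub>v x))\<^sup>2 = (vnorm x)\<^sup>2 - 2 * e * Re ((A *\<^sub>v x) \<bullet>c x) + e\<^sup>2 * (vnorm (A *\<^sub>v x))\<^sup>2"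
      using vnorm_minus_sq[OF x y] e by (simp add: vnorm_smult power_mult_distrib)
    also have "\<dots> \<le> (vnorm x)\<^sup>2 - 2 * e * (d * (vnorm x)\<^sup>2) + e\<^sup>2 * (K * vnorm x)\<^sup>2"
      using d(2)[OF x] K(2)[OF x] e by (intro add_mono diff_mono mult_left_mono power_mono) auto
    also have "\<dots> = (1 - 2 * e * d + e * (e * K\<^sup>2)) * (vnorm x)\<^sup>2"
      by (simp add: algebra_simps power2_eq_square)
    also have "\<dots> \<le> (1 - e * d) * (vnorm x)\<^sup>2"
      using mult_left_mono[OF e1(1), of e] e by (intro mult_right_mono) auto
    also have "\<dots> = (c * vnorm x)\<^sup>2" using e1 by (simp add: c_def power_mult_distrib)
    finally show "vnorm (C *\<^sub>v x) \<le> c * vnorm x"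
      by (rule power2_le_imp_le) (use c in auto)
  qed
  then obtain S where S: "S \<in> carrier_mat n n" "pos_def S" "S * S = 1\<^sub>m n - C"
    using contraction_sqrt[of C n c] A c minus_carrier_mat[of "complex_of_real e \<cdot>\<^sub>m A" n n "1\<^sub>m n"]
    by (auto simp: C_def)
  have SA: "S * S = complex_of_real e \<cdot>\<^sub>m A"
    unfolding S(3) C_def using A by (intro eq_matI) auto
  let ?r = "1 / sqrt e"
  have "pos_def (complex_of_real ?r \<cdot>\<^sub>m S)" using S e by (intro pos_def_smult[of _ n]) auto
  moreover have "(complex_of_real ?r \<cdot>\<^sub>m S) * (complex_of_real ?r \<cdot>\<^sub>m S) = A"
  proof -
    have "(complex_of_real ?r \<cdot>\<^sub>m S) * (complex_of_real ?r \<cdot>\<^sub>m S)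
      = (complex_of_real ?r * complex_of_real ?r) \<cdot>\<^sub>m (S * S)"
      using S(1) by (intro eq_matI) (auto simp: mult_mat_index[of _ n n _ n] sum_distrib_left mult_ac simp del: index_mult_mat(1))
    also have "complex_of_real ?r * complex_of_real ?r = complex_of_real (1 / e)"
      unfolding of_real_mult[symmetric] using e by simp
    finally show ?thesis unfolding SA using A e by (intro eq_matI) auto
  qed
  ultimately show ?thesis using that[of "complex_of_real ?r \<cdot>\<^sub>m S"] S(1) by simp
qed

section \<open>Integral representation and uniqueness of the square root\<close>

lemma mat_inv:
  assumes A: "A \<in> carrier_mat n n" and "det A \<noteq> 0"
  shows "mat_inv A \<in> carrier_mat n n" "A * mat_inv A = 1\<^sub>m n"
proof -
  have "A \<in> Units (ring_mat TYPE(complex) n ())"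
    using det_non_zero_imp_unit[OF assms] .
  then obtain B where "mat_inverse A = Some B"
    using mat_inverse(1)[OF A, where b = "()"] by (cases "mat_inverse A") auto
  then show "mat_inv A \<in> carrier_mat n n" "A * mat_inv A = 1\<^sub>m n"
    using mat_inverse(2)[OF A] by (auto simp: mat_inv_def)
qed

lemma mult_mat_vec_inj:
  fixes A :: "complex mat"
  assumes A: "A \<in> carrier_mat n n" and "det A \<noteq> 0"
    and x: "x \<in> carrier_vec n" and y: "y \<in> carrier_vec n" and eq: "A *\<^sub>v x = A *\<^sub>v y"
  shows "x = y"
proof -
  have "A *\<^sub>v (x - y) = 0\<^sub>v n"
    using A x y eq by (simp add: mult_minus_distrib_mat_vec[of _ n n])
  then have z: "x - y = 0\<^sub>v n"
    using det_0_iff_vec_prod_zero[OF A] assms(2) x y minus_carrier_vec by blast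
  show ?thesis
  proof (rule eq_vecI)
    fix i assume i: "i < dim_vec y"
    have "(x - y) $ i = 0" using z i y by simp
    then show "x $ i = y $ i" using i x y by simp
  qed (use x y in simp)
qed

text \<open>The sign is \<open>A + w I\<close>, so that for a positive-definite \<open>A\<close> the
  closed right half-plane consists of invertible shifts.\<close>

definition shift :: "complex mat \<Rightarrow> complex \<Rightarrow> complex mat" where
  "shift A w = A + w \<cdot>\<^sub>m 1\<^sub>m (dim_row A)"

definition resolvent :: "complex mat \<Rightarrow> complex \<Rightarrow> complex vec \<Rightarrow> complex vec" where
  "resolvent A w b = mat_inv (shift A w) *\<^sub>v b"

lemma shift_carrier: "A \<in> carrier_mat n n \<Longrightarrow> shift A w \<in> carrier_mat n n"
  by (auto simp: shift_def)

lemma shift_index: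
  "A \<in> carrier_mat n n \<Longrightarrow> i < n \<Longrightarrow> j < n \<Longrightarrow> shift A w $$ (i, j) = A $$ (i, j) + (if i = j then w else 0)"
  by (auto simp: shift_def)

lemma shift_mult_vec:
  assumes "A \<in> carrier_mat n n" "x \<in> carrier_vec n"
  shows "shift A w *\<^sub>v x = A *\<^sub>v x + w \<cdot>\<^sub>v x"
  using assms by (simp add: shift_def add_mult_distrib_mat_vec[of _ n n] smult_mat_mult_vec[of _ n n])

text \<open>A kernel vector \<open>v\<close> of the shift would give
  \<open>(d + Re w) |v|^2 \<le> 0\<close>. The condition \<open>Re w > - d\<close> reaches beyond
  the imaginary axis and so provides an open domain for holomorphy.\<close>

lemma det_shift_coercive:
  assumes A: "A \<in> carrier_mat n n"
    and d: "\<And>x. x \<in> carrier_vec n \<Longrightarrow> d * (vnorm x)\<^sup>2 \<le> Re ((A *\<^sub>v x) \<bullet>c x)"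
    and w: "Re w > - d"
  shows "det (shift A w) \<noteq> 0"
proof
  assume "det (shift A w) = 0"
  then obtain v where v: "v \<in> carrier_vec n" "v \<noteq> 0\<^sub>v n" "A *\<^sub>v v + w \<cdot>\<^sub>v v = 0\<^sub>v n"
    using det_0_iff_vec_prod_zero[OF shift_carrier[OF A]] shift_mult_vec[OF A] by auto
  have "(A *\<^sub>v v) \<bullet>c v + w * (v \<bullet>c v) = (A *\<^sub>v v + w \<cdot>\<^sub>v v) \<bullet>c v"
    using A v(1) by (simp add: add_scalar_prod_distrib[of _ n])
  also have "\<dots> = 0" using v(1) by (simp add: v(3))
  finally have "Re ((A *\<^sub>v v) \<bullet>c v) + Re w * (vnorm v)\<^sup>2 = 0"
    unfolding cscalar_prod_self[OF v(1)] by (simp add: complex_eq_iff del: of_real_power)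
  then have "(d + Re w) * (vnorm v)\<^sup>2 \<le> 0" using d[OF v(1)] by (simp add: algebra_simps)
  moreover have "vnorm v > 0" using v vnorm_eq_0_iff[OF v(1)] by (simp add: order_less_le)
  ultimately show False using w by (simp add: mult_le_0_iff)
qed

lemma det_shift_pos_def:
  assumes "A \<in> carrier_mat n n" "pos_def A" "Re w \<ge> 0"
  shows "det (shift A w) \<noteq> 0"
proof -
  obtain d where "d > 0" "\<And>x. x \<in> carrier_vec n \<Longrightarrow> d * (vnorm x)\<^sup>2 \<le> Re ((A *\<^sub>v x) \<bullet>c x)"
    using pos_def_coercive[OF assms(1,2)] by blast
  then show ?thesis using det_shift_coercive[OF assms(1), of d w] assms(3) by auto
qed

lemma resolvent:
  assumes A: "A \<in> carrier_mat n n" and nz: "det (shift A w) \<noteq> 0" and b: "b \<in> carrier_vec n"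
  shows "resolvent A w b \<in> carrier_vec n"
    and "A *\<^sub>v resolvent A w b + w \<cdot>\<^sub>v resolvent A w b = b"
proof -
  note inv = mat_inv[OF shift_carrier[OF A] nz]
  show c: "resolvent A w b \<in> carrier_vec n"
    using inv(1) b by (simp add: resolvent_def)
  have "shift A w *\<^sub>v resolvent A w b = (shift A w * mat_inv (shift A w)) *\<^sub>v b"
    unfolding resolvent_def using assoc_mult_mat_vec[OF shift_carrier[OF A] inv(1) b] by simp
  then show "A *\<^sub>v resolvent A w b + w \<cdot>\<^sub>v resolvent A w b = b"
    using inv(2) b shift_mult_vec[OF A c] by simp
qed

lemma resolvent_unique:
  assumes A: "A \<in> carrier_mat n n" and nz: "det (shift A w) \<noteq> 0" and u: "u \<in> carrier_vec n"
    and eq: "A *\<^sub>v u + w \<cdot>\<^sub>v u = b"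
  shows "resolvent A w b = u"
proof (rule mult_mat_vec_inj[OF shift_carrier[OF A] nz])
  have b: "b \<in> carrier_vec n" using A u eq by auto
  show "resolvent A w b \<in> carrier_vec n" by (rule resolvent(1)[OF A nz b])
  show "shift A w *\<^sub>v resolvent A w b = shift A w *\<^sub>v u"
    using resolvent[OF A nz b] shift_mult_vec[OF A] u eq by simp
qed fact

section \<open>Analytic behaviour of the resolvent\<close>

lemma det_holomorphic:
  assumes F: "\<And>w. F w \<in> carrier_mat n n"
    and hol: "\<And>i j. i < n \<Longrightarrow> j < n \<Longrightarrow> (\<lambda>w. F w $$ (i, j)) holomorphic_on U"
  shows "(\<lambda>w. det (F w)) holomorphic_on U"
proof -
  have *: "p i < n" if "p permutes {0..<n}" "i < n" for p i
    using permutes_in_image[OF that(1), of i] that(2) by simp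
  show ?thesis
    unfolding det_def'[OF F] by (intro holomorphic_intros hol) (auto intro: *)
qed

text \<open>By Cramer's rule each coordinate of the resolvent is a quotient of determinants whose
  entries are constant or affine in \<open>w\<close>.\<close>

lemma resolvent_holomorphic:
  assumes A: "A \<in> carrier_mat n n" and nz: "\<And>w. w \<in> U \<Longrightarrow> det (shift A w) \<noteq> 0"
    and b: "b \<in> carrier_vec n" and c: "c \<in> carrier_vec n"
  shows "(\<lambda>w. resolvent A w b \<bullet>c c) holomorphic_on U"
proof -
  have shift_hol: "(\<lambda>w. shift A w $$ (i, j)) holomorphic_on U" if "i < n" "j < n" for i j
    using that by (cases "i = j") (auto simp: shift_index[OF A] intro!: holomorphic_intros)
  have "(\<lambda>w. \<Sum>i<n. det (replace_col (shift A w) b i) / det (shift A w) * cnj (c $ i)) holomorphic_on U"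
  proof (intro holomorphic_intros det_holomorphic[where n = n])
    fix i :: nat and w
    show "replace_col (shift A w) b i \<in> carrier_mat n n"
      using shift_carrier[OF A, of w] by (auto simp: replace_col_def)
    fix k l assume kl: "k < n" "l < n"
    have "replace_col (shift A w) b i $$ (k, l) = (if l = i then b $ k else shift A w $$ (k, l))" for w
      using shift_carrier[OF A, of w] kl by (simp add: replace_col_def carrier_matD)
    then show "(\<lambda>w. replace_col (shift A w) b i $$ (k, l)) holomorphic_on U"
      using kl shift_hol by (cases "l = i") (auto intro!: holomorphic_intros)
  qed (use shift_carrier[OF A] shift_hol nz in auto)
  then show ?thesis
  proof (rule holomorphic_transform)
    fix w assume w: "w \<in> U"
    note R = resolvent[OF A nz[OF w] b]
    have "resolvent A w b $ i = det (replace_col (shift A w) b i) / det (shift A w)" if "i < n" for i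
      using cramer_lemma_mat[OF shift_carrier[OF A] R(1) that, of w] R nz[OF w] shift_mult_vec[OF A R(1)]
      by (simp add: field_simps)
    then show "(\<Sum>i<n. det (replace_col (shift A w) b i) / det (shift A w) * cnj (c $ i)) = resolvent A w b \<bullet>c c"
      using cscalar_prod_sum[OF R(1) c] by simp
  qed
qed

text \<open>For \<open>u = (A + w I)^(-1) b\<close> one has \<open>(w + 1) u - b = u - A u\<close>,
  of norm at most \<open>(1 + K) |u|\<close>, while \<open>|u| \<le> 2 |b| / |w|\<close> for large
  \<open>w\<close>. Comparing with \<open>1 / (w + 1)\<close> instead of \<open>1 / w\<close> keeps
  the comparison term free of poles in the closed right half-plane, where moreover
  \<open>|w| \<le> |w + 1|\<close>.\<close>

lemma resolvent_decay:
  assumes A: "A \<in> carrier_mat n n" and nz: "det (shift A w) \<noteq> 0"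
    and b: "b \<in> carrier_vec n" and c: "c \<in> carrier_vec n"
    and K: "K \<ge> 0" "op_le n A K" and w: "Re w \<ge> 0" "cmod w \<ge> 2 * K + 1"
  shows "cmod (resolvent A w b \<bullet>c c - b \<bullet>c c / (w + 1)) \<le> 2 * (1 + K) * vnorm b * vnorm c / (cmod w)\<^sup>2"
proof -
  define u where "u = resolvent A w b"
  have u: "u \<in> carrier_vec n" and eq: "A *\<^sub>v u + w \<cdot>\<^sub>v u = b"
    using resolvent[OF A nz b] by (auto simp: u_def)
  have Au: "A *\<^sub>v u \<in> carrier_vec n" using A u by simp
  have w0: "cmod w > 0" using w(2) K(1) by linarith
  have w1: "cmod w \<le> cmod (w + 1)"
  proof (rule power2_le_imp_le)
    show "(cmod w)\<^sup>2 \<le> (cmod (w + 1))\<^sup>2"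
      unfolding cmod_power2 using w(1) by (simp add: power_mono)
  qed simp
  have "w \<cdot>\<^sub>v u = b - A *\<^sub>v u"
    using Au u A by (intro eq_vecI) (auto simp: eq[symmetric] simp del: index_mult_mat_vec)
  then have "cmod w * vnorm u \<le> vnorm b + K * vnorm u"
    using vnorm_minus_le[OF b Au] op_leD[OF K(2) u] vnorm_smult[of w u] by simp
  \<comment> \<open>Since \<open>K\<close> is at most half of \<open>|w|\<close>, this term can be
    absorbed into the left-hand side.\<close>
  moreover have "K * vnorm u \<le> cmod w / 2 * vnorm u"
    using w by (intro mult_right_mono) auto
  ultimately have "vnorm u \<le> 2 * vnorm b / cmod w"
    using w0 by (simp add: field_simps)
  then have uc: "vnorm u * vnorm c \<le> 2 * vnorm b / cmod w * vnorm c"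
    by (intro mult_right_mono) auto
  have "b \<bullet>c c = (A *\<^sub>v u) \<bullet>c c + w * (u \<bullet>c c)"
    using Au u c by (simp add: eq[symmetric] add_scalar_prod_distrib[of _ n])
  then have "(w + 1) * (u \<bullet>c c) - b \<bullet>c c = u \<bullet>c c - (A *\<^sub>v u) \<bullet>c c"
    by (simp add: algebra_simps)
  also have "cmod \<dots> \<le> vnorm u * vnorm c + K * vnorm u * vnorm c"
    using cscalar_prod_le[OF u c] cscalar_prod_le[OF Au c] mult_right_mono[OF op_leD[OF K(2) u], of "vnorm c"]
    by (intro order.trans[OF norm_triangle_ineq4] add_mono) auto
  also have "\<dots> = (1 + K) * (vnorm u * vnorm c)" by (simp add: algebra_simps)
  also have "\<dots> \<le> (1 + K) * (2 * vnorm b / cmod w * vnorm c)"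
    using K uc by (intro mult_left_mono) auto
  finally have 1: "cmod ((w + 1) * (u \<bullet>c c) - b \<bullet>c c) \<le> 2 * (1 + K) * vnorm b * vnorm c / cmod w"
    by (simp add: mult_ac)
  have "w + 1 \<noteq> 0" using w0 w1 by auto
  then have "cmod (u \<bullet>c c - b \<bullet>c c / (w + 1)) = cmod ((w + 1) * (u \<bullet>c c) - b \<bullet>c c) / cmod (w + 1)"
    by (simp add: norm_divide[symmetric] field_simps)
  also have "\<dots> \<le> (2 * (1 + K) * vnorm b * vnorm c / cmod w) / cmod w"
    using 1 w0 w1 K by (intro frac_le) auto
  finally show ?thesis by (simp add: u_def power2_eq_square)
qed

text \<open>The increment is estimated along the three other sides of a rectangle, so that no
  contour integral is needed.\<close>

lemma increment_imaginary_axis: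
  assumes G: "\<And>w. Re w \<ge> 0 \<Longrightarrow> (G has_field_derivative g w) (at w)"
    and C: "\<And>w. Re w \<ge> 0 \<Longrightarrow> cmod w \<ge> R \<Longrightarrow> cmod (g w) \<le> C / (cmod w)\<^sup>2" "C \<ge> 0"
    and R: "R > 0"
  shows "cmod (G (\<i> * R) - G (- \<i> * R)) \<le> 4 * C / R"
proof -
  \<comment> \<open>Each of the three sides lies in a convex part of the right half-plane outside
    the open disc of radius \<open>R\<close>, where the derivative is at most
    \<open>C / R^2\<close>. The sides have lengths \<open>R\<close>, \<open>2 R\<close> and
    \<open>R\<close>.\<close>
  have step: "cmod (G x - G y) \<le> C / R\<^sup>2 * cmod (x - y)"
    if "convex T" "x \<in> T" "y \<in> T" "\<And>z. z \<in> T \<Longrightarrow> Re z \<ge> 0 \<and> cmod z \<ge> R" for T x y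
  proof (rule field_differentiable_bound[OF that(1) _ _ that(2,3)])
    fix z assume "z \<in> T"
    then have z: "Re z \<ge> 0" "cmod z \<ge> R" using that(4) by auto
    show "(G has_field_derivative g z) (at z within T)"
      using G[OF z(1)] by (rule has_field_derivative_at_within)
    have "cmod z > 0" using z R by linarith
    then have "C / (cmod z)\<^sup>2 \<le> C / R\<^sup>2"
      using z R C(2) by (intro divide_left_mono power_mono) auto
    then show "cmod (g z) \<le> C / R\<^sup>2" using C(1)[OF z] by simp
  qed
  have 1: "cmod (G (\<i> * R) - G (R + \<i> * R)) \<le> C / R\<^sup>2 * cmod (\<i> * R - (R + \<i> * R))"
  proof (rule step[of "{z. Re z \<ge> 0} \<inter> {z. Im z \<ge> R}"])
    fix z assume "z \<in> {z. Re z \<ge> 0} \<inter> {z. Im z \<ge> R}"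
    then show "Re z \<ge> 0 \<and> cmod z \<ge> R" using abs_Im_le_cmod[of z] by auto
  qed (use R in \<open>auto intro!: convex_Int convex_halfspace_Re_ge convex_halfspace_Im_ge\<close>)
  have 2: "cmod (G (R + \<i> * R) - G (R - \<i> * R)) \<le> C / R\<^sup>2 * cmod ((R + \<i> * R) - (R - \<i> * R))"
  proof (rule step[of "{z. Re z \<ge> R}"])
    fix z assume "z \<in> {z. Re z \<ge> R}"
    then show "Re z \<ge> 0 \<and> cmod z \<ge> R" using abs_Re_le_cmod[of z] R by auto
  qed (use R in \<open>auto intro!: convex_halfspace_Re_ge\<close>)
  have 3: "cmod (G (R - \<i> * R) - G (- \<i> * R)) \<le> C / R\<^sup>2 * cmod ((R - \<i> * R) - (- \<i> * R))"
  proof (rule step[of "{z. Re z \<ge> 0} \<inter> {z. Im z \<le> - R}"])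
    fix z assume "z \<in> {z. Re z \<ge> 0} \<inter> {z. Im z \<le> - R}"
    then show "Re z \<ge> 0 \<and> cmod z \<ge> R" using abs_Im_le_cmod[of z] by auto
  qed (use R in \<open>auto intro!: convex_Int convex_halfspace_Re_ge convex_halfspace_Im_le\<close>)
  have "cmod (G (\<i> * R) - G (- \<i> * R)) \<le> cmod (G (\<i> * R) - G (R + \<i> * R))
      + cmod (G (R + \<i> * R) - G (R - \<i> * R)) + cmod (G (R - \<i> * R) - G (- \<i> * R))"
    using norm_triangle_ineq[of "G (\<i> * R) - G (R + \<i> * R)" "G (R + \<i> * R) - G (R - \<i> * R)"]
      norm_triangle_ineq[of "G (\<i> * R) - G (R - \<i> * R)" "G (R - \<i> * R) - G (- \<i> * R)"] by simp
  also have "\<dots> \<le> C / R\<^sup>2 * R + C / R\<^sup>2 * (2 * R) + C / R\<^sup>2 * R"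
  proof -
    have "(R + \<i> * R) - (R - \<i> * R) = of_real (2 * R) * \<i>" by (simp add: algebra_simps)
    then have "cmod ((R + \<i> * R) - (R - \<i> * R)) = 2 * R" using R by (simp add: norm_mult)
    then show ?thesis using 1 2 3 R by (intro add_mono) (auto simp: norm_minus_commute)
  qed
  also have "\<dots> = 4 * C / R" using R by (simp add: field_simps power2_eq_square)
  finally show ?thesis .
qed

text \<open>Since \<open>(S + w I) (S - w I) = A - w^2 I\<close>, the vector
  \<open>(S + w I)^(-1) S b\<close> equals \<open>(S - w I) S u\<close> with
  \<open>u = (A - w^2 I)^(-1) b\<close>. For imaginary \<open>w\<close> the shift
  \<open>- w^2\<close> is real and nonnegative, so \<open>u\<close> is well defined.\<close>

lemma sqrt_resolvent_split:
  assumes S: "S \<in> carrier_mat n n" "pos_def S" and A: "A \<in> carrier_mat n n" "pos_def A" "S * S = A"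
    and b: "b \<in> carrier_vec n" and w: "Re w = 0"
  shows "resolvent S w (S *\<^sub>v b) = A *\<^sub>v resolvent A (- (w\<^sup>2)) b - w \<cdot>\<^sub>v (S *\<^sub>v resolvent A (- (w\<^sup>2)) b)"
proof (rule resolvent_unique[OF S(1) det_shift_pos_def[OF S]])
  define u where "u = resolvent A (- (w\<^sup>2)) b"
  have "Re (- (w\<^sup>2)) \<ge> 0" using w by (simp add: Re_power2)
  then have u: "u \<in> carrier_vec n" and eq: "A *\<^sub>v u + (- (w\<^sup>2)) \<cdot>\<^sub>v u = b"
    using resolvent[OF A(1) det_shift_pos_def[OF A(1,2)] b] by (auto simp: u_def)
  have SS: "S *\<^sub>v (S *\<^sub>v x) = A *\<^sub>v x" if "x \<in> carrier_vec n" for x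
    using that S(1) A(3) assoc_mult_mat_vec[of S n n S n x] by simp
  let ?x = "S *\<^sub>v u" and ?y = "A *\<^sub>v u"
  have xy: "?x \<in> carrier_vec n" "?y \<in> carrier_vec n" using S A u by auto
  have "S *\<^sub>v b = S *\<^sub>v ?y + (- (w\<^sup>2)) \<cdot>\<^sub>v ?x"
    using S(1) u xy by (simp add: eq[symmetric] mult_add_distrib_mat_vec[of _ n n] mult_mat_vec[of _ n n])
  moreover have "S *\<^sub>v (?y - w \<cdot>\<^sub>v ?x) = S *\<^sub>v ?y - w \<cdot>\<^sub>v ?y"
    using S(1) xy SS[OF u] by (simp add: mult_minus_distrib_mat_vec[of _ n n] mult_mat_vec[of _ n n])
  moreover have "S *\<^sub>v ?y \<in> carrier_vec n" using S(1) xy by simp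
  ultimately show "S *\<^sub>v (?y - w \<cdot>\<^sub>v ?x) + w \<cdot>\<^sub>v (?y - w \<cdot>\<^sub>v ?x) = S *\<^sub>v b"
    using xy by (simp only:) (intro eq_vecI, auto simp: carrier_matD[OF S(1)] carrier_matD[OF A(1)]
        algebra_simps power2_eq_square simp del: index_mult_mat_vec)
  show "?y - w \<cdot>\<^sub>v ?x \<in> carrier_vec n" using xy by auto
qed (use w in simp)

text \<open>With \<open>w = \<i> s\<close> and \<open>w = - \<i> s\<close> the terms in
  \<open>S u\<close> cancel and the integrand becomes \<open>f (\<i> * s) + f (- \<i> * s)\<close>.
  The part \<open>p / (w + 1)\<close> of \<open>f\<close> integrates to an arctangent with limit
  \<open>pi * p\<close>; the rest is of order \<open>1 / |w|^2\<close> and contributes nothing in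
  the limit. The improper integral is expressed through the truncated integrals
  \<open>P R\<close>.\<close>

lemma sqrt_integral:
  assumes S: "S \<in> carrier_mat n n" "pos_def S" and A: "A \<in> carrier_mat n n" "pos_def A" "S * S = A"
    and b: "b \<in> carrier_vec n" and c: "c \<in> carrier_vec n"
  obtains P where
    "\<And>R. R \<ge> 0 \<Longrightarrow> ((\<lambda>s. 2 * ((A *\<^sub>v resolvent A (complex_of_real (s\<^sup>2)) b) \<bullet>c c)) has_integral P R) {0..R}"
    "(P \<longlongrightarrow> complex_of_real pi * ((S *\<^sub>v b) \<bullet>c c)) at_top"
proof -
  have Sb: "S *\<^sub>v b \<in> carrier_vec n" using S b by simp
  define p where "p = (S *\<^sub>v b) \<bullet>c c"
  define f where "f w = resolvent S w (S *\<^sub>v b) \<bullet>c c" for w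
  define g where "g w = f w - p / (w + 1)" for w
  obtain d where d: "d > 0" "\<And>x. x \<in> carrier_vec n \<Longrightarrow> d * (vnorm x)\<^sup>2 \<le> Re ((S *\<^sub>v x) \<bullet>c x)"
    using pos_def_coercive[OF S] by blast
  obtain K where K: "K \<ge> 0" "op_le n S K"
    using mat_vec_bounded[OF S(1)] unfolding op_le_def by metis
  \<comment> \<open>An open convex neighbourhood of the closed right half-plane, so that a primitive
    exists and is differentiable on the imaginary axis. The bound \<open>d\<close> keeps the shifts
    of \<open>S\<close> invertible, the bound \<open>1\<close> excludes the pole of
    \<open>p / (w + 1)\<close>.\<close>
  define U where "U = {w. Re w > - min d 1}"
  have U: "convex U" "open U" unfolding U_def
    by (rule convex_halfspace_Re_gt open_halfspace_Re_gt)+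
  have nz: "det (shift S w) \<noteq> 0" if "w \<in> U" for w
    using det_shift_coercive[OF S(1) d(2)] that by (auto simp: U_def)
  have "w + 1 \<noteq> 0" if "w \<in> U" for w
    using that by (auto simp: U_def complex_eq_iff)
  then have "g holomorphic_on U"
    unfolding g_def f_def by (intro holomorphic_intros resolvent_holomorphic[OF S(1) _ Sb c] nz) auto
  then obtain G where G: "\<And>w. w \<in> U \<Longrightarrow> (G has_field_derivative g w) (at w within U)"
    using holomorphic_convex_primitive'[OF U] by metis
  have GD: "(G has_field_derivative g w) (at w)" if "Re w \<ge> 0" for w
  proof -
    have "w \<in> U" using that d by (auto simp: U_def min_def)
    then show ?thesis using G[of w] at_within_open[OF _ U(2)] by simp
  qed
  define C where "C = 2 * (1 + K) * vnorm (S *\<^sub>v b) * vnorm c"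
  have C: "C \<ge> 0" using K by (simp add: C_def)
  have decay: "cmod (g w) \<le> C / (cmod w)\<^sup>2" if "Re w \<ge> 0" "cmod w \<ge> 2 * K + 1" for w
    using resolvent_decay[OF S(1) det_shift_pos_def[OF S that(1)] Sb c K that]
    by (simp add: g_def f_def p_def C_def)
  \<comment> \<open>The explicit antiderivative:
    \<open>p / (\<i> s + 1) + p / (- \<i> s + 1) = 2 p / (1 + s^2)\<close> produces the arctangent,
    and the division by \<open>\<i>\<close> undoes the chain rule along the imaginary axis.\<close>
  define P where "P s = 2 * p * complex_of_real (arctan s) + (G (\<i> * of_real s) - G (- \<i> * of_real s)) / \<i>" for s
  have int: "2 * ((A *\<^sub>v resolvent A (complex_of_real (s\<^sup>2)) b) \<bullet>c c) = f (\<i> * s) + f (- \<i> * s)" for s :: real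
  proof -
    let ?u = "resolvent A (complex_of_real (s\<^sup>2)) b"
    have u: "?u \<in> carrier_vec n"
      by (rule resolvent(1)[OF A(1) det_shift_pos_def[OF A(1,2)] b]) (simp flip: of_real_power)
    have sq: "- ((\<i> * s)\<^sup>2) = complex_of_real (s\<^sup>2)" "- ((- \<i> * s)\<^sup>2) = complex_of_real (s\<^sup>2)"
      by (simp_all add: power2_eq_square algebra_simps)
    have xy: "A *\<^sub>v ?u \<in> carrier_vec n" "S *\<^sub>v ?u \<in> carrier_vec n" using A S u by auto
    have "f (\<i> * s) = (A *\<^sub>v ?u - (\<i> * s) \<cdot>\<^sub>v (S *\<^sub>v ?u)) \<bullet>c c"
      unfolding f_def using sqrt_resolvent_split[OF S A b, of "\<i> * s"] unfolding sq by simp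
    moreover have "f (- \<i> * s) = (A *\<^sub>v ?u - (- \<i> * s) \<cdot>\<^sub>v (S *\<^sub>v ?u)) \<bullet>c c"
      unfolding f_def using sqrt_resolvent_split[OF S A b, of "- \<i> * s"] unfolding sq by simp
    ultimately show ?thesis
      using xy c by (simp add: minus_scalar_prod_distrib[of _ n])
  qed
  have der: "(P has_vector_derivative (f (\<i> * s) + f (- \<i> * s))) (at s)" for s :: real
  proof -
    have "(G \<circ> (\<lambda>s. \<i> * of_real s) has_vector_derivative (\<i> * g (\<i> * s))) (at s)"
      by (rule field_vector_diff_chain_at) (auto intro!: derivative_eq_intros GD)
    moreover have "(G \<circ> (\<lambda>s. - \<i> * of_real s) has_vector_derivative (- \<i> * g (- \<i> * s))) (at s)"
      by (rule field_vector_diff_chain_at) (auto intro!: derivative_eq_intros GD)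
    moreover have "((\<lambda>s. complex_of_real (arctan s)) has_vector_derivative of_real (inverse (1 + s\<^sup>2))) (at s)"
      by (rule has_vector_derivative_of_real) (auto intro!: derivative_eq_intros simp: field_simps)
    ultimately have "(P has_vector_derivative 2 * p * of_real (inverse (1 + s\<^sup>2))
        + (\<i> * g (\<i> * s) - - \<i> * g (- \<i> * s)) / \<i>) (at s)"
      unfolding P_def o_def
      by (intro has_vector_derivative_add has_vector_derivative_mult_right has_vector_derivative_divide
          has_vector_derivative_diff)
    moreover have "2 * p * of_real (inverse (1 + s\<^sup>2)) + (\<i> * g (\<i> * s) - - \<i> * g (- \<i> * s)) / \<i>
        = f (\<i> * s) + f (- \<i> * s)"
    proof -
      have nz: "\<i> * s + 1 \<noteq> 0" "- \<i> * s + 1 \<noteq> 0" by (auto simp: complex_eq_iff)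
      have "1 + complex_of_real (s\<^sup>2) = (\<i> * s + 1) * (- \<i> * s + 1)"
        by (simp add: power2_eq_square algebra_simps)
      then have "2 * p * of_real (inverse (1 + s\<^sup>2)) = 2 * p / ((\<i> * s + 1) * (- \<i> * s + 1))"
        by (simp add: field_simps flip: of_real_power)
      also have "\<dots> = p / (\<i> * s + 1) + p / (- \<i> * s + 1)"
        using nz by (simp add: add_frac_eq algebra_simps)
      finally have "2 * p * of_real (inverse (1 + s\<^sup>2)) = p / (\<i> * s + 1) + p / (- \<i> * s + 1)" .
      moreover have "(\<i> * x - - \<i> * y) / \<i> = x + y" for x y :: complex
        by (simp add: field_simps)
      ultimately show ?thesis unfolding g_def by simp
    qed
    ultimately show ?thesis by simp
  qed
  have "P 0 = 0" by (simp add: P_def)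
  have 1: "((\<lambda>s. 2 * ((A *\<^sub>v resolvent A (complex_of_real (s\<^sup>2)) b) \<bullet>c c)) has_integral P R) {0..R}"
    if "R \<ge> 0" for R
  proof -
    have "((\<lambda>s. f (\<i> * of_real s) + f (- \<i> * of_real s)) has_integral (P R - P 0)) {0..R}"
      using that der by (intro fundamental_theorem_of_calculus) (auto intro: has_vector_derivative_at_within)
    then show ?thesis unfolding int using \<open>P 0 = 0\<close> by simp
  qed
  have "((\<lambda>s. G (\<i> * complex_of_real s) - G (- \<i> * complex_of_real s)) \<longlongrightarrow> 0) at_top"
  proof (rule Lim_null_comparison)
    show "eventually (\<lambda>s. cmod (G (\<i> * complex_of_real s) - G (- \<i> * complex_of_real s)) \<le> 4 * C / s) at_top"
      using eventually_ge_at_top[of "2 * K + 1"]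
    proof eventually_elim
      case (elim s)
      show ?case
        by (rule increment_imaginary_axis[of G g]) (use GD decay C elim K in auto)
    qed
    show "((\<lambda>s. 4 * C / s) \<longlongrightarrow> 0) at_top"
      by (intro real_tendsto_divide_at_top[OF tendsto_const] filterlim_ident)
  qed
  then have "(P \<longlongrightarrow> 2 * p * complex_of_real (pi / 2) + 0 / \<i>) at_top"
    unfolding P_def by (intro tendsto_intros tendsto_arctan_at_top) auto
  then have 2: "(P \<longlongrightarrow> complex_of_real pi * ((S *\<^sub>v b) \<bullet>c c)) at_top"
    by (simp add: p_def mult.commute)
  show ?thesis using that[of P] 1 2 by blast
qed

text \<open>The truncated integrals in \<open>sqrt_integral\<close> depend on \<open>A\<close> only,
  so their limits agree for \<open>S\<close> and \<open>T\<close>. Unit vectors in both slots single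
  out one matrix entry.\<close>

lemma mat_sqrt_unique:
  assumes A: "A \<in> carrier_mat n n" "pos_def A"
    and S: "S \<in> carrier_mat n n" "pos_def S" "S * S = A"
    and T: "T \<in> carrier_mat n n" "pos_def T" "T * T = A"
  shows "S = T"
proof (rule eq_matI)
  fix i j assume "i < dim_row T" "j < dim_col T"
  then have i: "i < n" and j: "j < n" using T by auto
  have entry: "(X *\<^sub>v unit_vec n j) \<bullet>c unit_vec n i = X $$ (i, j)" if "X \<in> carrier_mat n n" for X :: "complex mat"
  proof -
    have "(X *\<^sub>v unit_vec n j) \<bullet>c unit_vec n i = (\<Sum>l<n. if l = i then (X *\<^sub>v unit_vec n j) $ i else 0)"
      unfolding cscalar_prod_sum[OF mult_mat_vec_carrier[OF that unit_vec_carrier] unit_vec_carrier]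
      using i by (intro sum.cong) (auto simp: unit_vec_def simp del: index_mult_mat_vec)
    also have "\<dots> = (X *\<^sub>v unit_vec n j) $ i" using i by simp
    also have "\<dots> = X $$ (i, j)" using that i j by simp
    finally show ?thesis .
  qed
  obtain P where P: "\<And>R. R \<ge> 0 \<Longrightarrow> ((\<lambda>s. 2 * ((A *\<^sub>v resolvent A (complex_of_real (s\<^sup>2)) (unit_vec n j)) \<bullet>c unit_vec n i)) has_integral P R) {0..R}"
    "(P \<longlongrightarrow> complex_of_real pi * ((S *\<^sub>v unit_vec n j) \<bullet>c unit_vec n i)) at_top"
    using sqrt_integral[OF S(1,2) A S(3) unit_vec_carrier unit_vec_carrier] by blast
  obtain P' where P': "\<And>R. R \<ge> 0 \<Longrightarrow> ((\<lambda>s. 2 * ((A *\<^sub>v resolvent A (complex_of_real (s\<^sup>2)) (unit_vec n j)) \<bullet>c unit_vec n i)) has_integral P' R) {0..R}"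
    "(P' \<longlongrightarrow> complex_of_real pi * ((T *\<^sub>v unit_vec n j) \<bullet>c unit_vec n i)) at_top"
    using sqrt_integral[OF T(1,2) A T(3) unit_vec_carrier unit_vec_carrier] by blast
  have "eventually (\<lambda>R. P R = P' R) at_top"
    using eventually_ge_at_top[of 0] by eventually_elim (use P(1) P'(1) has_integral_unique in blast)
  then have "(P \<longlongrightarrow> complex_of_real pi * ((T *\<^sub>v unit_vec n j) \<bullet>c unit_vec n i)) at_top"
    using P'(2) by (simp add: tendsto_cong)
  from tendsto_unique[OF _ P(2) this] show "S $$ (i, j) = T $$ (i, j)"
    by (simp add: entry[OF S(1)] entry[OF T(1)])
qed (use S T in auto)

text \<open>Existence and uniqueness together give the definite description its intended
  value.\<close>

lemma mat_sqrt:
  assumes A: "A \<in> carrier_mat n n" "pos_def A"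
  shows "mat_sqrt A \<in> carrier_mat n n" "pos_def (mat_sqrt A)" "mat_sqrt A * mat_sqrt A = A"
proof -
  obtain S where S: "S \<in> carrier_mat n n" "pos_def S" "S * S = A"
    using pos_def_sqrt_exists[OF A] by blast
  have dim: "dim_row A = n" using A by simp
  have "mat_sqrt A = S"
    unfolding mat_sqrt_def dim using S mat_sqrt_unique[OF A _ _ _ S] by (intro the_equality) blast+
  then show "mat_sqrt A \<in> carrier_mat n n" "pos_def (mat_sqrt A)" "mat_sqrt A * mat_sqrt A = A"
    using S by auto
qed

section \<open>The Arnoldi process\<close>

lemma mgs_append: "mgs (qs @ [q]) w = mgs qs w - (mgs qs w \<bullet>c q) \<cdot>\<^sub>v q"
  by (simp add: mgs_def)

lemma mgs_Nil [simp]: "mgs [] w = w"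
  by (simp add: mgs_def)

lemma mgs_carrier:
  assumes "w \<in> carrier_vec n" "set qs \<subseteq> carrier_vec n"
  shows "mgs qs w \<in> carrier_vec n"
  using assms(2) by (induction qs rule: rev_induct) (use assms(1) in \<open>auto simp: mgs_append\<close>)

text \<open>Induction from the end of the list: the last projection removes the component along the
  last vector and, by orthonormality, does not disturb the zeros already achieved.\<close>

lemma mgs_orthogonal:
  assumes "w \<in> carrier_vec n" "set qs \<subseteq> carrier_vec n"
    and "\<And>i j. i < length qs \<Longrightarrow> j < length qs \<Longrightarrow> qs ! i \<bullet>c qs ! j = (if i = j then 1 else 0)"
    and "i < length qs"
  shows "mgs qs w \<bullet>c qs ! i = 0"
  using assms(2-)
proof (induction qs arbitrary: i rule: rev_induct)
  case (snoc q qs)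
  have orth: "(qs @ [q]) ! i \<bullet>c (qs @ [q]) ! j = (if i = j then 1 else 0)"
    if "i \<le> length qs" "j \<le> length qs" for i j
    using snoc.prems(2)[of i j] that by simp
  have c: "mgs qs w \<in> carrier_vec n" "q \<in> carrier_vec n" "(qs @ [q]) ! i \<in> carrier_vec n"
    using mgs_carrier[OF assms(1), of qs] snoc.prems(1) nth_mem[OF snoc.prems(3)] by auto
  have *: "mgs (qs @ [q]) w \<bullet>c (qs @ [q]) ! i
    = mgs qs w \<bullet>c (qs @ [q]) ! i - (mgs qs w \<bullet>c q) * (q \<bullet>c (qs @ [q]) ! i)"
    using c by (simp add: mgs_append minus_scalar_prod_distrib[of _ n])
  show ?case
  proof (cases "i = length qs")
    case True
    then show ?thesis using * orth[of i i] by simp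
  next
    case False
    then have i: "i < length qs" using snoc.prems(3) by simp
    have "mgs qs w \<bullet>c qs ! i = 0"
    proof (rule snoc.IH[OF _ _ i])
      show "qs ! a \<bullet>c qs ! b = (if a = b then 1 else 0)" if "a < length qs" "b < length qs" for a b
        using orth[of a b] that by (simp add: nth_append)
    qed (use snoc.prems(1) in auto)
    then show ?thesis using * orth[of "length qs" i] i by (simp add: nth_append)
  qed
qed simp

text \<open>The removed components add up to the original vector. Each coefficient is formed with
  the vector current after \<open>i\<close> projections, hence \<open>take i qs\<close>, exactly as
  in \<open>arnoldi_h\<close>.\<close>

lemma mgs_decomposition:
  assumes "w \<in> carrier_vec n" "set qs \<subseteq> carrier_vec n" "l < n"
  shows "w $ l = mgs qs w $ l + (\<Sum>i<length qs. (mgs (take i qs) w \<bullet>c qs ! i) * qs ! i $ l)"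
  using assms(2)
proof (induction qs rule: rev_induct)
  case (snoc q qs)
  have c: "mgs qs w \<in> carrier_vec n" "q \<in> carrier_vec n"
    using mgs_carrier[OF assms(1), of qs] snoc.prems by auto
  have "(\<Sum>i<length qs. (mgs (take i (qs @ [q])) w \<bullet>c (qs @ [q]) ! i) * (qs @ [q]) ! i $ l)
    = (\<Sum>i<length qs. (mgs (take i qs) w \<bullet>c qs ! i) * qs ! i $ l)"
    by (intro sum.cong) (auto simp: nth_append)
  then show ?case using snoc c assms(3) by (simp add: mgs_append)
qed simp

section \<open>Arnoldi vectors and coefficients by index\<close>

lemma length_arnoldi_vecs [simp]: "length (arnoldi_vecs M b k) = k"
  by (induction M b k rule: arnoldi_vecs.induct) (auto simp: Let_def)

text \<open>Since the list \<open>arnoldi_vecs M b k\<close> only grows with \<open>k\<close>, its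
  entry \<open>j\<close> can be named independently of \<open>k\<close>.\<close>

definition arnoldi_q :: "complex mat \<Rightarrow> complex vec \<Rightarrow> nat \<Rightarrow> complex vec" where
  "arnoldi_q M b j = arnoldi_vecs M b (Suc j) ! j"

text \<open>The next vector before normalization. At the last step it is the common direction of the
  residuals of all shifted systems.\<close>

definition arnoldi_w :: "complex mat \<Rightarrow> complex vec \<Rightarrow> nat \<Rightarrow> complex vec" where
  "arnoldi_w M b j = mgs (arnoldi_vecs M b (Suc j)) (M *\<^sub>v arnoldi_q M b j)"

lemma arnoldi_vecs_snoc: "arnoldi_vecs M b (Suc k) = arnoldi_vecs M b k @ [arnoldi_q M b k]"
  by (cases k) (auto simp: arnoldi_q_def Let_def nth_append)

lemma arnoldi_vecs_eq_map: "arnoldi_vecs M b k = map (arnoldi_q M b) [0..<k]"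
  by (induction k) (auto simp: arnoldi_vecs_snoc simp del: arnoldi_vecs.simps(2,3))

lemma arnoldi_q_0: "arnoldi_q M b 0 = complex_of_real (1 / vnorm b) \<cdot>\<^sub>v b"
  by (simp add: arnoldi_q_def)

lemma arnoldi_q_Suc:
  "arnoldi_q M b (Suc j) = complex_of_real (1 / vnorm (arnoldi_w M b j)) \<cdot>\<^sub>v arnoldi_w M b j"
proof -
  have "arnoldi_q M b (Suc j) = arnoldi_vecs M b (Suc (Suc j)) ! Suc j"
    by (simp only: arnoldi_q_def)
  also have "\<dots> = complex_of_real (1 / vnorm (arnoldi_w M b j)) \<cdot>\<^sub>v arnoldi_w M b j"
    unfolding arnoldi_vecs.simps(3) Let_def arnoldi_w_def arnoldi_q_def by (simp add: nth_append)
  finally show ?thesis .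
qed

lemma arnoldi_h_upper:
  "i \<le> j \<Longrightarrow> arnoldi_h M b i j = mgs (arnoldi_vecs M b i) (M *\<^sub>v arnoldi_q M b j) \<bullet>c arnoldi_q M b i"
  unfolding arnoldi_h_def Let_def arnoldi_vecs_eq_map
  by (simp add: take_map take_upt nth_append del: upt_Suc)

lemma arnoldi_h_subdiag: "arnoldi_h M b (Suc j) j = complex_of_real (vnorm (arnoldi_w M b j))"
  unfolding arnoldi_h_def Let_def arnoldi_w_def by (simp add: arnoldi_q_def)

lemma arnoldi_h_lower: "i > Suc j \<Longrightarrow> arnoldi_h M b i j = 0"
  by (simp add: arnoldi_h_def Let_def)

lemma adjoint_carrier_index:
  fixes A :: "complex mat"
  assumes "A \<in> carrier_mat m n"
  shows "mat_adjoint A \<in> carrier_mat n m"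
    and "i < n \<Longrightarrow> j < m \<Longrightarrow> mat_adjoint A $$ (i, j) = cnj (A $$ (j, i))"
  using assms by (auto simp: mat_adjoint_def mat_of_rows_index)

lemma cscalar_prod_adjoint:
  fixes A :: "complex mat"
  assumes A: "A \<in> carrier_mat m n" and x: "x \<in> carrier_vec n" and y: "y \<in> carrier_vec m"
  shows "(A *\<^sub>v x) \<bullet>c y = x \<bullet>c (mat_adjoint A *\<^sub>v y)"
proof -
  note B = adjoint_carrier_index[OF A]
  have "(A *\<^sub>v x) \<bullet>c y = (\<Sum>i<m. \<Sum>j<n. A $$ (i, j) * x $ j * cnj (y $ i))"
    using A x y by (simp add: cscalar_prod_sum[of _ m] mult_mat_vec_index[of _ m n] sum_distrib_right del: index_mult_mat_vec)
  also have "\<dots> = (\<Sum>j<n. \<Sum>i<m. A $$ (i, j) * x $ j * cnj (y $ i))" by (rule sum.swap)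
  also have "\<dots> = x \<bullet>c (mat_adjoint A *\<^sub>v y)"
    using B x y by (simp add: cscalar_prod_sum[of _ n] mult_mat_vec_index[of _ n m] sum_distrib_left mult_ac del: index_mult_mat_vec)
  finally show ?thesis .
qed

section \<open>Orthonormality, the Arnoldi relation and the projected matrix\<close>

context
  fixes M :: "complex mat" and b :: "complex vec" and n :: nat
  assumes M: "M \<in> carrier_mat n n" and b: "b \<in> carrier_vec n" and b0: "b \<noteq> 0\<^sub>v n"
begin

lemma vnorm_b: "vnorm b > 0"
  using vnorm_eq_0_iff[OF b] b0 by (simp add: order_less_le)

lemma arnoldi_q_carrier: "arnoldi_q M b j \<in> carrier_vec n"
proof (induction j rule: less_induct)
  case (less j)
  show ?case
  proof (cases j)
    case (Suc i)
    have "arnoldi_w M b i \<in> carrier_vec n"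
      unfolding arnoldi_w_def arnoldi_vecs_eq_map using M less Suc by (intro mgs_carrier) auto
    then show ?thesis by (simp add: Suc arnoldi_q_Suc)
  qed (use b in \<open>simp add: arnoldi_q_0\<close>)
qed

lemma arnoldi_w_carrier: "arnoldi_w M b j \<in> carrier_vec n"
  unfolding arnoldi_w_def arnoldi_vecs_eq_map using M arnoldi_q_carrier by (intro mgs_carrier) auto

text \<open>Orthonormality of the first \<open>m + 1\<close> vectors appears as a hypothesis because
  this is the induction step for \<open>arnoldi_q_orthonormal\<close>.\<close>

lemma arnoldi_w_orthogonal:
  assumes orth: "\<And>i j. i \<le> m \<Longrightarrow> j \<le> m \<Longrightarrow> arnoldi_q M b i \<bullet>c arnoldi_q M b j = (if i = j then 1 else 0)"
    and i: "i \<le> m"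
  shows "arnoldi_w M b m \<bullet>c arnoldi_q M b i = 0"
proof -
  have nth: "arnoldi_vecs M b (Suc m) ! i = arnoldi_q M b i" if "i \<le> m" for i
    unfolding arnoldi_vecs_eq_map using that by (simp del: upt_Suc)
  have "arnoldi_w M b m \<bullet>c arnoldi_vecs M b (Suc m) ! i = 0"
    unfolding arnoldi_w_def
  proof (rule mgs_orthogonal)
    show "set (arnoldi_vecs M b (Suc m)) \<subseteq> carrier_vec n"
      unfolding arnoldi_vecs_eq_map using arnoldi_q_carrier by auto
    show "arnoldi_vecs M b (Suc m) ! i \<bullet>c arnoldi_vecs M b (Suc m) ! j = (if i = j then 1 else 0)"
      if "i < length (arnoldi_vecs M b (Suc m))" "j < length (arnoldi_vecs M b (Suc m))" for i j
      using that orth nth by simp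
  qed (use M arnoldi_q_carrier i in auto)
  then show ?thesis using nth[OF i] by simp
qed

lemma arnoldi_q_orthonormal:
  assumes "arnoldi_defined M b k" "i < k" "j < k"
  shows "arnoldi_q M b i \<bullet>c arnoldi_q M b j = (if i = j then 1 else 0)"
  using assms
proof (induction k arbitrary: i j)
  case (Suc k)
  have IH: "arnoldi_q M b i \<bullet>c arnoldi_q M b j = (if i = j then 1 else 0)" if "i < k" "j < k" for i j
    using Suc that by (auto simp: arnoldi_defined_def)
  have unit: "arnoldi_q M b k \<bullet>c arnoldi_q M b k = 1"
    if "arnoldi_q M b k = complex_of_real (1 / vnorm x) \<cdot>\<^sub>v x" "vnorm x \<noteq> 0" for x
  proof -
    have "vnorm (arnoldi_q M b k) = 1" using that by (simp add: vnorm_smult norm_divide)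
    then show ?thesis using cscalar_prod_self[OF arnoldi_q_carrier, of k] by simp
  qed
  show ?case
  proof (cases k)
    case 0
    then show ?thesis using Suc.prems unit[of b] vnorm_b by (simp add: arnoldi_q_0)
  next
    case (Suc m)
    \<comment> \<open>The absence of breakdown before the new vector means that its unnormalized
      form is nonzero, so the normalization really yields a unit vector.\<close>
    have "arnoldi_h M b (Suc m) m \<noteq> 0" using Suc.prems(1) Suc by (auto simp: arnoldi_defined_def)
    then have nz: "vnorm (arnoldi_w M b m) \<noteq> 0" by (simp add: arnoldi_h_subdiag)
    have qk: "arnoldi_q M b k \<bullet>c arnoldi_q M b k = 1"
      using unit[of "arnoldi_w M b m"] nz by (simp add: Suc arnoldi_q_Suc)
    have q: "arnoldi_q M b k \<bullet>c arnoldi_q M b i = 0" if "i < k" for i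
      using arnoldi_w_orthogonal[of m i] IH that
        smult_scalar_prod_distrib[OF arnoldi_w_carrier carrier_vec_conjugate[OF arnoldi_q_carrier]]
      by (simp add: Suc arnoldi_q_Suc)
    have q': "arnoldi_q M b i \<bullet>c arnoldi_q M b k = 0" if "i < k" for i
      using cscalar_prod_cnj[OF arnoldi_q_carrier arnoldi_q_carrier, of k i] q[OF that] by simp
    show ?thesis using Suc.prems(2,3) IH qk q q' by (auto simp: less_Suc_eq)
  qed
qed simp

text \<open>Column \<open>j\<close> of \<open>M Q = Q H + w e^T\<close>, with \<open>e\<close> the
  last unit vector. For \<open>j < m\<close> what is left after orthogonalization equals
  \<open>h * q\<close> with indices \<open>j + 1, j\<close> and \<open>j + 1\<close>, and joins the
  sum; only for \<open>j = m\<close> does it remain as an extra term.\<close>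

lemma arnoldi_column:
  assumes def: "arnoldi_defined M b (Suc m)" and j: "j \<le> m" and l: "l < n"
  shows "(M *\<^sub>v arnoldi_q M b j) $ l
    = (\<Sum>i\<le>m. arnoldi_h M b i j * arnoldi_q M b i $ l) + (if j = m then arnoldi_w M b m $ l else 0)"
proof -
  have "(M *\<^sub>v arnoldi_q M b j) $ l = arnoldi_w M b j $ l + (\<Sum>i<Suc j. (mgs (take i (arnoldi_vecs M b (Suc j)))
      (M *\<^sub>v arnoldi_q M b j) \<bullet>c arnoldi_vecs M b (Suc j) ! i) * arnoldi_vecs M b (Suc j) ! i $ l)"
    using mgs_decomposition[of "M *\<^sub>v arnoldi_q M b j" n "arnoldi_vecs M b (Suc j)" l] M arnoldi_q_carrier l
    by (auto simp: arnoldi_w_def arnoldi_vecs_eq_map)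
  also have "(\<Sum>i<Suc j. (mgs (take i (arnoldi_vecs M b (Suc j)))
      (M *\<^sub>v arnoldi_q M b j) \<bullet>c arnoldi_vecs M b (Suc j) ! i) * arnoldi_vecs M b (Suc j) ! i $ l)
    = (\<Sum>i<Suc j. arnoldi_h M b i j * arnoldi_q M b i $ l)"
    by (intro sum.cong) (auto simp: arnoldi_h_upper arnoldi_vecs_eq_map take_map simp del: upt_Suc)
  finally have *: "(M *\<^sub>v arnoldi_q M b j) $ l = arnoldi_w M b j $ l + (\<Sum>i<Suc j. arnoldi_h M b i j * arnoldi_q M b i $ l)" .
  show ?thesis
  proof (cases "j = m")
    case True
    then show ?thesis using * by (simp add: lessThan_Suc_atMost)
  next
    case False
    then have jm: "Suc j \<le> m" using j by simp
    have "arnoldi_h M b (Suc j) j \<noteq> 0" using def jm by (auto simp: arnoldi_defined_def)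
    then have nz: "vnorm (arnoldi_w M b j) \<noteq> 0" by (simp add: arnoldi_h_subdiag)
    have "arnoldi_w M b j $ l = arnoldi_h M b (Suc j) j * arnoldi_q M b (Suc j) $ l"
      using nz arnoldi_w_carrier[of j] l by (simp add: arnoldi_h_subdiag arnoldi_q_Suc)
    then have "(M *\<^sub>v arnoldi_q M b j) $ l = (\<Sum>i\<le>Suc j. arnoldi_h M b i j * arnoldi_q M b i $ l)"
      using * by (simp add: lessThan_Suc_atMost)
    also have "\<dots> = (\<Sum>i\<le>m. arnoldi_h M b i j * arnoldi_q M b i $ l)"
      using jm by (intro sum.mono_neutral_left) (auto simp: arnoldi_h_lower)
    finally show ?thesis using False by simp
  qed
qed

lemma arnoldi_Q_carrier: "arnoldi_Q M b k \<in> carrier_mat n k"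
  using M by (simp add: arnoldi_Q_def mat_of_cols_def)

lemma arnoldi_Q_index:
  assumes "l < n" "j < k"
  shows "arnoldi_Q M b k $$ (l, j) = arnoldi_q M b j $ l"
  using assms M by (simp add: arnoldi_Q_def mat_of_cols_index arnoldi_vecs_eq_map)

lemma arnoldi_H_carrier: "arnoldi_H M b k \<in> carrier_mat k k"
  by (simp add: arnoldi_H_def)

text \<open>The columnwise identities are combined with the coefficients of \<open>y\<close>; only
  the last coordinate \<open>y $ m\<close> meets the remainder. As this remainder is not normalized,
  a breakdown at the last step is just the case in which it vanishes.\<close>

lemma arnoldi_relation:
  assumes def: "arnoldi_defined M b (Suc m)" and y: "y \<in> carrier_vec (Suc m)"
  shows "M *\<^sub>v (arnoldi_Q M b (Suc m) *\<^sub>v y)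
    = arnoldi_Q M b (Suc m) *\<^sub>v (arnoldi_H M b (Suc m) *\<^sub>v y) + y $ m \<cdot>\<^sub>v arnoldi_w M b m"
proof (rule eq_vecI)
  let ?Q = "arnoldi_Q M b (Suc m)" and ?H = "arnoldi_H M b (Suc m)"
  note Q = arnoldi_Q_carrier[of "Suc m"] and H = arnoldi_H_carrier[of "Suc m"]
  note index = mult_mat_vec_index[OF Q] mult_mat_vec_index[OF M] mult_mat_vec_index[OF H]
  fix l assume "l < dim_vec (?Q *\<^sub>v (?H *\<^sub>v y) + y $ m \<cdot>\<^sub>v arnoldi_w M b m)"
  then have l: "l < n" using arnoldi_w_carrier[of m] by simp
  have "(M *\<^sub>v (?Q *\<^sub>v y)) $ l = (\<Sum>r<n. \<Sum>j<Suc m. M $$ (l, r) * (arnoldi_q M b j $ r * y $ j))"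
    using l y Q by (simp add: index arnoldi_Q_index sum_distrib_left del: index_mult_mat_vec sum.lessThan_Suc)
  also have "\<dots> = (\<Sum>j<Suc m. (M *\<^sub>v arnoldi_q M b j) $ l * y $ j)"
    using l arnoldi_q_carrier by (subst sum.swap)
      (simp add: index sum_distrib_right mult.assoc del: index_mult_mat_vec sum.lessThan_Suc)
  also have "\<dots> = (\<Sum>j<Suc m. ((\<Sum>i<Suc m. arnoldi_h M b i j * arnoldi_q M b i $ l)
      + (if j = m then arnoldi_w M b m $ l else 0)) * y $ j)"
    using arnoldi_column[OF def _ l] by (intro sum.cong) (auto simp: lessThan_Suc_atMost)
  also have "\<dots> = (\<Sum>j<Suc m. \<Sum>i<Suc m. arnoldi_h M b i j * arnoldi_q M b i $ l * y $ j)
      + (\<Sum>j<Suc m. if j = m then y $ m * arnoldi_w M b m $ l else 0)"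
    unfolding sum.distrib[symmetric] by (intro sum.cong) (auto simp: sum_distrib_right distrib_right)
  also have "(\<Sum>j<Suc m. if j = m then y $ m * arnoldi_w M b m $ l else 0) = y $ m * arnoldi_w M b m $ l"
    by simp
  also have "(\<Sum>j<Suc m. \<Sum>i<Suc m. arnoldi_h M b i j * arnoldi_q M b i $ l * y $ j)
      = (?Q *\<^sub>v (?H *\<^sub>v y)) $ l"
  proof -
    have "?H *\<^sub>v y \<in> carrier_vec (Suc m)" using H y by simp
    moreover have "?H $$ (i, j) = arnoldi_h M b i j" if "i < Suc m" "j < Suc m" for i j
      using that by (simp add: arnoldi_H_def)
    ultimately show ?thesis
      using l y by (subst sum.swap)
        (simp add: index arnoldi_Q_index sum_distrib_left mult_ac del: index_mult_mat_vec sum.lessThan_Suc)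
  qed
  finally show "(M *\<^sub>v (?Q *\<^sub>v y)) $ l = (?Q *\<^sub>v (?H *\<^sub>v y) + y $ m \<cdot>\<^sub>v arnoldi_w M b m) $ l"
    using l Q arnoldi_w_carrier[of m] by (simp del: index_mult_mat_vec)
qed (use M arnoldi_w_carrier[of m] in simp)

lemma adjoint_arnoldi_Q_index:
  assumes "x \<in> carrier_vec n" "i < k"
  shows "(mat_adjoint (arnoldi_Q M b k) *\<^sub>v x) $ i = x \<bullet>c arnoldi_q M b i"
  using assms adjoint_carrier_index(1)[OF arnoldi_Q_carrier, of k] adjoint_carrier_index(2)[OF arnoldi_Q_carrier assms(2)]
    arnoldi_q_carrier
  by (simp add: mult_mat_vec_index[of _ k n] cscalar_prod_sum[of _ n] arnoldi_Q_index mult.commute del: index_mult_mat_vec)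

lemma adjoint_arnoldi_w:
  assumes "arnoldi_defined M b (Suc m)"
  shows "mat_adjoint (arnoldi_Q M b (Suc m)) *\<^sub>v arnoldi_w M b m = 0\<^sub>v (Suc m)"
proof (rule eq_vecI)
  fix i assume "i < dim_vec (0\<^sub>v (Suc m) :: complex vec)"
  then have i: "i < Suc m" by simp
  show "(mat_adjoint (arnoldi_Q M b (Suc m)) *\<^sub>v arnoldi_w M b m) $ i = 0\<^sub>v (Suc m) $ i"
    unfolding adjoint_arnoldi_Q_index[OF arnoldi_w_carrier i]
    using arnoldi_w_orthogonal[of m i] arnoldi_q_orthonormal[OF assms] i by auto
qed (use adjoint_carrier_index[OF arnoldi_Q_carrier, of "Suc m"] in simp)

lemma adjoint_arnoldi_Q:
  assumes "arnoldi_defined M b k" "y \<in> carrier_vec k"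
  shows "mat_adjoint (arnoldi_Q M b k) *\<^sub>v (arnoldi_Q M b k *\<^sub>v y) = y"
proof (rule eq_vecI)
  note Q = arnoldi_Q_carrier[of k]
  fix i assume "i < dim_vec y"
  then have i: "i < k" using assms by simp
  have "(mat_adjoint (arnoldi_Q M b k) *\<^sub>v (arnoldi_Q M b k *\<^sub>v y)) $ i = (arnoldi_Q M b k *\<^sub>v y) \<bullet>c arnoldi_q M b i"
    using adjoint_arnoldi_Q_index[of "arnoldi_Q M b k *\<^sub>v y" i k] Q assms i by simp
  also have "\<dots> = y \<bullet>c (mat_adjoint (arnoldi_Q M b k) *\<^sub>v arnoldi_q M b i)"
    by (rule cscalar_prod_adjoint[OF Q assms(2) arnoldi_q_carrier])
  also have "mat_adjoint (arnoldi_Q M b k) *\<^sub>v arnoldi_q M b i = unit_vec k i"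
    using i assms adjoint_carrier_index[OF Q]
    by (intro eq_vecI) (auto simp: adjoint_arnoldi_Q_index arnoldi_q_carrier arnoldi_q_orthonormal simp del: index_mult_mat_vec)
  also have "y \<bullet>c unit_vec k i = (\<Sum>j<k. if j = i then y $ i else 0)"
    unfolding cscalar_prod_sum[OF assms(2) unit_vec_carrier] using i
    by (intro sum.cong) (auto simp: unit_vec_def)
  also have "\<dots> = y $ i" using i by simp
  finally show "(mat_adjoint (arnoldi_Q M b k) *\<^sub>v (arnoldi_Q M b k *\<^sub>v y)) $ i = y $ i" .
qed (use assms adjoint_carrier_index[OF arnoldi_Q_carrier, of k] in simp)

lemma arnoldi_Q_start:
  assumes "k \<ge> 1"
  shows "arnoldi_Q M b k *\<^sub>v (complex_of_real (vnorm b) \<cdot>\<^sub>v unit_vec k 0) = b"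
proof (rule eq_vecI)
  fix l assume "l < dim_vec b"
  then have l: "l < n" using b by simp
  have "(arnoldi_Q M b k *\<^sub>v (complex_of_real (vnorm b) \<cdot>\<^sub>v unit_vec k 0)) $ l
    = (\<Sum>j<k. arnoldi_Q M b k $$ (l, j) * (complex_of_real (vnorm b) \<cdot>\<^sub>v unit_vec k 0) $ j)"
    using l by (intro mult_mat_vec_index[OF arnoldi_Q_carrier]) auto
  also have "\<dots> = (\<Sum>j<k. if j = 0 then arnoldi_q M b 0 $ l * vnorm b else 0)"
    using l by (intro sum.cong) (auto simp: arnoldi_Q_index)
  also have "\<dots> = b $ l" using assms l b vnorm_b by (simp add: arnoldi_q_0)
  finally show "(arnoldi_Q M b k *\<^sub>v (complex_of_real (vnorm b) \<cdot>\<^sub>v unit_vec k 0)) $ l = b $ l" .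
qed (use b arnoldi_Q_carrier[of k] in simp)

lemma arnoldi_Q_isometry:
  assumes "arnoldi_defined M b k" "x \<in> carrier_vec k" "y \<in> carrier_vec k"
  shows "(arnoldi_Q M b k *\<^sub>v x) \<bullet>c (arnoldi_Q M b k *\<^sub>v y) = x \<bullet>c y"
  using cscalar_prod_adjoint[OF arnoldi_Q_carrier assms(2), of "arnoldi_Q M b k *\<^sub>v y"]
    adjoint_arnoldi_Q[OF assms(1,3)] arnoldi_Q_carrier[of k] assms(3) by simp

text \<open>The quadratic form of \<open>H\<close> at \<open>x\<close> is that of \<open>M\<close>
  at \<open>Q x\<close>: the remainder \<open>w\<close> of the Arnoldi relation is orthogonal to the
  range of \<open>Q\<close>. Since \<open>Q\<close> is isometric, \<open>Q x\<close> is again a unit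
  vector.\<close>

lemma arnoldi_H_pos_def:
  assumes def: "arnoldi_defined M b (Suc m)" and pd: "pos_def M"
  shows "pos_def (arnoldi_H M b (Suc m))"
  unfolding pos_def_def
proof (intro conjI ballI impI)
  let ?Q = "arnoldi_Q M b (Suc m)" and ?H = "arnoldi_H M b (Suc m)"
  note Q = arnoldi_Q_carrier[of "Suc m"] and H = arnoldi_H_carrier[of "Suc m"]
  show "square_mat ?H" using H by simp
  fix x assume "x \<in> carrier_vec (dim_row ?H)" and n: "vnorm x = 1"
  then have x: "x \<in> carrier_vec (Suc m)" using H by simp
  have Qx: "?Q *\<^sub>v x \<in> carrier_vec n" using Q x by simp
  have Hx: "?H *\<^sub>v x \<in> carrier_vec (Suc m)" using H x by simp
  have "arnoldi_w M b m \<bullet>c (?Q *\<^sub>v x) = cnj ((?Q *\<^sub>v x) \<bullet>c arnoldi_w M b m)"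
    by (rule cscalar_prod_cnj[OF Qx arnoldi_w_carrier])
  also have "\<dots> = 0"
    using cscalar_prod_adjoint[OF Q x arnoldi_w_carrier] adjoint_arnoldi_w[OF def] x by simp
  finally have w: "arnoldi_w M b m \<bullet>c (?Q *\<^sub>v x) = 0" .
  have "(M *\<^sub>v (?Q *\<^sub>v x)) \<bullet>c (?Q *\<^sub>v x) = (?Q *\<^sub>v (?H *\<^sub>v x)) \<bullet>c (?Q *\<^sub>v x)"
    unfolding arnoldi_relation[OF def x] using Q Hx Qx arnoldi_w_carrier w
    by (simp add: add_scalar_prod_distrib[of _ n])
  also have "\<dots> = (?H *\<^sub>v x) \<bullet>c x" by (rule arnoldi_Q_isometry[OF def Hx x])
  finally have eq: "(M *\<^sub>v (?Q *\<^sub>v x)) \<bullet>c (?Q *\<^sub>v x) = (?H *\<^sub>v x) \<bullet>c x" .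
  have "(vnorm (?Q *\<^sub>v x))\<^sup>2 = (vnorm x)\<^sup>2"
    using arnoldi_Q_isometry[OF def x x] unfolding cscalar_prod_self[OF Qx] cscalar_prod_self[OF x] of_real_eq_iff .
  then have "vnorm (?Q *\<^sub>v x) = 1" using n by (simp add: power2_eq_1_iff) (use vnorm_nonneg[of "?Q *\<^sub>v x"] in linarith)
  then show "Re ((?H *\<^sub>v x) \<bullet>c x) > 0"
    using pd Qx M unfolding pos_def_def eq[symmetric] by auto
qed

end

section \<open>Shifted Hessenberg systems\<close>

text \<open>Cramer's rule puts the right-hand side into the last column. Laplace expansion along
  that column leaves the minor without first row and last column, which is upper triangular with the
  subdiagonal of \<open>H\<close> on its diagonal; the cofactor sign is \<open>(-1) ^ m\<close>. The
  point is that the right-hand side does not change when \<open>H\<close> is shifted.\<close>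

lemma hessenberg_solution_last:
  fixes H :: "complex mat"
  assumes H: "H \<in> carrier_mat (Suc m) (Suc m)"
    and hess: "\<And>i j. i \<le> m \<Longrightarrow> Suc j < i \<Longrightarrow> H $$ (i, j) = 0"
    and y: "y \<in> carrier_vec (Suc m)" and eq: "H *\<^sub>v y = a \<cdot>\<^sub>v unit_vec (Suc m) 0"
  shows "y $ m * det H = a * (- 1) ^ m * (\<Prod>i<m. H $$ (Suc i, i))"
proof -
  define B where "B = replace_col H (a \<cdot>\<^sub>v unit_vec (Suc m) 0) m"
  have B: "B \<in> carrier_mat (Suc m) (Suc m)" using H by (auto simp: B_def replace_col_def)
  have Bi: "B $$ (i, j) = (if j = m then if i = 0 then a else 0 else H $$ (i, j))"
    if "i \<le> m" "j \<le> m" for i j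
    using that H by (auto simp: B_def replace_col_def unit_vec_def)
  define D where "D = mat_delete B 0 m"
  have D: "D \<in> carrier_mat m m" using B by (auto simp: D_def mat_delete_def)
  have Di: "D $$ (i, j) = H $$ (Suc i, j)" if "i < m" "j < m" for i j
    using that B Bi by (auto simp: D_def mat_delete_def)
  have "y $ m * det H = det B"
    using cramer_lemma_mat[OF H y, of m] by (simp add: B_def eq)
  also have "\<dots> = (\<Sum>i<Suc m. B $$ (i, m) * cofactor B i m)"
    by (rule laplace_expansion_column[OF B]) simp
  also have "\<dots> = (\<Sum>i<Suc m. if i = 0 then a * cofactor B 0 m else 0)"
    by (intro sum.cong) (auto simp: Bi)
  also have "\<dots> = a * cofactor B 0 m" by (subst sum.delta) auto
  also have "\<dots> = a * (- 1) ^ m * det D" by (simp add: cofactor_def D_def)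
  also have "det D = prod_list (diag_mat D)"
  proof (rule det_upper_triangular[OF _ D])
    show "upper_triangular D" using D Di hess by (auto simp: upper_triangular_def)
  qed
  also have "\<dots> = (\<Prod>i<m. D $$ (i, i))"
    using D by (simp add: diag_mat_def prod.list_conv_set_nth lessThan_atLeast0)
  also have "\<dots> = (\<Prod>i<m. H $$ (Suc i, i))"
    by (intro prod.cong) (auto simp: Di)
  finally show ?thesis .
qed

text \<open>The characteristic polynomial at \<open>- t\<close> is the determinant of
  \<open>- (H + t I)\<close>; the sign \<open>(-1) ^ k\<close> arises on both sides and
  cancels.\<close>

lemma det_shift_char_poly:
  assumes H: "H \<in> carrier_mat k k" and cp: "char_poly H = (\<Prod>i=1..k. [:- lam i, 1:])"
  shows "det (shift H t) = (\<Prod>i=1..k. lam i + t)"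
proof -
  have "det (- char_matrix H (- t)) = (\<Prod>i=1..k. - t - lam i)"
    using char_poly_matrix[OF H, of "- t"] unfolding cp poly_prod by (simp add: algebra_simps)
  moreover have "- char_matrix H (- t) = (- 1) \<cdot>\<^sub>m shift H t"
    using H by (intro eq_matI) (auto simp: char_matrix_def shift_def)
  moreover have "dim_col (shift H t) = k" using shift_carrier[OF H] by auto
  ultimately have "(- 1) ^ k * det (shift H t) = (\<Prod>i=1..k. (- 1) * (lam i + t))"
    by (simp add: algebra_simps)
  also have "\<dots> = (- 1) ^ k * (\<Prod>i=1..k. lam i + t)"
    by (subst prod.distrib) simp
  finally show ?thesis by simp
qed

text \<open>This is the contraction property of \<open>(M + t I)^(-1) M\<close>. With
  \<open>y = z - x\<close> one has \<open>M y = t x\<close>, so positivity of \<open>M\<close> at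
  \<open>y\<close> gives \<open>t Re <x, y> \<ge> 0\<close>, and expanding \<open>|x + y|^2\<close>
  shows that \<open>z\<close> is at least as long as \<open>x\<close>.\<close>

lemma shifted_solution_le:
  assumes M: "M \<in> carrier_mat n n" "pos_def M" and x: "x \<in> carrier_vec n" and z: "z \<in> carrier_vec n"
    and t: "t \<ge> 0" and eq: "M *\<^sub>v x + complex_of_real t \<cdot>\<^sub>v x = M *\<^sub>v z"
  shows "vnorm x \<le> vnorm z"
proof -
  define y where "y = z - x"
  have y: "y \<in> carrier_vec n" using x z by (simp add: y_def)
  have My: "M *\<^sub>v y = complex_of_real t \<cdot>\<^sub>v x"
    unfolding y_def mult_minus_distrib_mat_vec[OF M(1) z x] eq[symmetric]
    using M(1) x by (intro eq_vecI) (auto simp del: index_mult_mat_vec)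
  obtain d where d: "d > 0" "\<And>x. x \<in> carrier_vec n \<Longrightarrow> d * (vnorm x)\<^sup>2 \<le> Re ((M *\<^sub>v x) \<bullet>c x)"
    using pos_def_coercive[OF M] by blast
  have le: "d * (vnorm y)\<^sup>2 \<le> t * Re (x \<bullet>c y)"
    using d(2)[OF y] x y by (simp add: My)
  have *: "(vnorm x)\<^sup>2 = (vnorm z)\<^sup>2 - 2 * Re (x \<bullet>c y) - (vnorm y)\<^sup>2"
  proof -
    have "z = y + x" using x z by (intro eq_vecI) (auto simp: y_def)
    then have "z \<bullet>c z = y \<bullet>c y + y \<bullet>c x + (x \<bullet>c y + x \<bullet>c x)"
      using x y by (simp add: cscalar_prod_sum[of _ n] sum.distrib algebra_simps)
    then have "Re (z \<bullet>c z) = Re (y \<bullet>c y) + Re (y \<bullet>c x) + (Re (x \<bullet>c y) + Re (x \<bullet>c x))" by simp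
    moreover have "Re (y \<bullet>c x) = Re (x \<bullet>c y)" using cscalar_prod_cnj[OF x y] by simp
    ultimately show ?thesis
      by (simp add: cscalar_prod_self[OF x] cscalar_prod_self[OF y] cscalar_prod_self[OF z])
  qed
  have "2 * Re (x \<bullet>c y) + (vnorm y)\<^sup>2 \<ge> 0"
  \<comment> \<open>For \<open>t = 0\<close> coercivity says nothing about the inner product, but it
    forces \<open>y = 0\<close>.\<close>
  proof (cases "t = 0")
    case True
    then have "vnorm y = 0" using le d(1) by (simp add: mult_le_0_iff)
    then have "y = 0\<^sub>v n" using vnorm_eq_0_iff[OF y] by simp
    then show ?thesis using x by simp
  next
    case False
    have "0 \<le> d * (vnorm y)\<^sup>2" using d(1) by simp
    then have "Re (x \<bullet>c y) \<ge> 0" using le False t by (smt (verit) mult_pos_neg)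
    then show ?thesis by simp
  qed
  then have "(vnorm x)\<^sup>2 \<le> (vnorm z)\<^sup>2" using * by linarith
  then show ?thesis by (rule power2_le_imp_le) simp
qed

section \<open>The error bound\<close>

context
  fixes M :: "complex mat" and b :: "complex vec" and n m :: nat and lam :: "nat \<Rightarrow> complex"
  assumes M: "M \<in> carrier_mat n n" and pd: "pos_def M"
    and b: "b \<in> carrier_vec n" and b0: "b \<noteq> 0\<^sub>v n"
    and def: "arnoldi_defined M b (Suc m)"
    and cp: "char_poly (arnoldi_H M b (Suc m)) = (\<Prod>i=1..Suc m. [:- lam i, 1:])"
begin

lemma Q_carrier: "arnoldi_Q M b (Suc m) \<in> carrier_mat n (Suc m)"
  by (rule arnoldi_Q_carrier[OF M b b0])

lemma H_pos_def: "arnoldi_H M b (Suc m) \<in> carrier_mat (Suc m) (Suc m)" "pos_def (arnoldi_H M b (Suc m))"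
  by (rule arnoldi_H_carrier[OF M b b0] arnoldi_H_pos_def[OF M b b0 def pd])+

text \<open>A vanishing factor would make the determinant of \<open>H + t I\<close> zero, against
  the positive-definiteness of \<open>H\<close>. This keeps the integrand of the bound continuous on
  the half-line.\<close>

lemma lam_shift_nonzero:
  assumes "t \<ge> 0" "i \<in> {1..Suc m}"
  shows "lam i + complex_of_real t \<noteq> 0"
proof
  assume "lam i + complex_of_real t = 0"
  then have "(\<Prod>i=1..Suc m. lam i + complex_of_real t) = 0"
    using assms(2) by (intro prod_zero) auto
  then show False
    using det_shift_char_poly[OF H_pos_def(1) cp, of "complex_of_real t"] det_shift_pos_def[OF H_pos_def, of "complex_of_real t"] assms(1)
    by simp
qed

section \<open>Errors and residuals of the shifted systems\<close>

definition start_vec :: "complex vec" where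
  "start_vec = complex_of_real (vnorm b) \<cdot>\<^sub>v unit_vec (Suc m) 0"

lemma start_vec: "start_vec \<in> carrier_vec (Suc m)"
  "arnoldi_Q M b (Suc m) *\<^sub>v start_vec = b"
  "mat_adjoint (arnoldi_Q M b (Suc m)) *\<^sub>v b = start_vec"
proof -
  show 1: "start_vec \<in> carrier_vec (Suc m)" by (simp add: start_vec_def)
  show 2: "arnoldi_Q M b (Suc m) *\<^sub>v start_vec = b"
    unfolding start_vec_def by (rule arnoldi_Q_start[OF M b b0]) simp
  show "mat_adjoint (arnoldi_Q M b (Suc m)) *\<^sub>v b = start_vec"
    using adjoint_arnoldi_Q[OF M b b0 def 1] by (simp add: 2)
qed

text \<open>The error of the Full Orthogonalization Method for the shifted matrix \<open>M + t I\<close>.\<close>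

definition shifted_error :: "real \<Rightarrow> complex vec" where
  "shifted_error t = resolvent M (complex_of_real t) b
    - arnoldi_Q M b (Suc m) *\<^sub>v resolvent (arnoldi_H M b (Suc m)) (complex_of_real t) start_vec"

lemma resolvents:
  assumes "t \<ge> 0"
  defines "u \<equiv> resolvent M (complex_of_real t) b"
    and "y \<equiv> resolvent (arnoldi_H M b (Suc m)) (complex_of_real t) start_vec"
  shows "u \<in> carrier_vec n" "M *\<^sub>v u + complex_of_real t \<cdot>\<^sub>v u = b"
    "y \<in> carrier_vec (Suc m)" "arnoldi_H M b (Suc m) *\<^sub>v y + complex_of_real t \<cdot>\<^sub>v y = start_vec"
  using assms(1) unfolding u_def y_def
  by (auto intro!: resolvent[OF M det_shift_pos_def[OF M pd] b]
      resolvent[OF H_pos_def(1) det_shift_pos_def[OF H_pos_def] start_vec(1)])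

lemma shifted_error_carrier: "t \<ge> 0 \<Longrightarrow> shifted_error t \<in> carrier_vec n"
  unfolding shifted_error_def using resolvents[of t] Q_carrier by simp

lemma fom_error_eq: "fom_error (Suc m) M b = shifted_error 0"
proof -
  have "shift A 0 = A" if "A \<in> carrier_mat k k" for A k
    using that by (intro eq_matI) (auto simp: shift_def)
  then show ?thesis
    using M H_pos_def(1) by (simp add: fom_error_def shifted_error_def resolvent_def start_vec_def)
qed

text \<open>The Arnoldi relation survives adding \<open>t I\<close> to both \<open>M\<close> and
  \<open>H\<close>, so the same \<open>Q\<close> and \<open>w\<close> serve for all
  \<open>t\<close>. The residual is therefore always a multiple of the one vector \<open>w\<close>,
  and only the last coordinate of \<open>y\<close> depends on \<open>t\<close>.\<close>

lemma shifted_residual: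
  assumes t: "t \<ge> 0"
  defines "y \<equiv> resolvent (arnoldi_H M b (Suc m)) (complex_of_real t) start_vec"
  shows "M *\<^sub>v shifted_error t + complex_of_real t \<cdot>\<^sub>v shifted_error t = - (y $ m) \<cdot>\<^sub>v arnoldi_w M b m"
proof -
  let ?Q = "arnoldi_Q M b (Suc m)" and ?H = "arnoldi_H M b (Suc m)" and ?w = "arnoldi_w M b m"
  define u where "u = resolvent M (complex_of_real t) b"
  have u: "u \<in> carrier_vec n" and eu: "M *\<^sub>v u + complex_of_real t \<cdot>\<^sub>v u = b"
    and y: "y \<in> carrier_vec (Suc m)" and ey: "?H *\<^sub>v y + complex_of_real t \<cdot>\<^sub>v y = start_vec"
    using resolvents[OF t] unfolding u_def y_def by auto
  have w: "?w \<in> carrier_vec n" by (rule arnoldi_w_carrier[OF M b b0])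
  have Hy: "?H *\<^sub>v y \<in> carrier_vec (Suc m)" using H_pos_def(1) y by simp
  have Qy: "?Q *\<^sub>v y \<in> carrier_vec n" using Q_carrier y by simp
  have QHy: "?Q *\<^sub>v (?H *\<^sub>v y) \<in> carrier_vec n" using Q_carrier Hy by simp
  have Mu: "M *\<^sub>v u \<in> carrier_vec n" using M u by simp
  have "?Q *\<^sub>v (?H *\<^sub>v y + complex_of_real t \<cdot>\<^sub>v y) = ?Q *\<^sub>v (?H *\<^sub>v y) + complex_of_real t \<cdot>\<^sub>v (?Q *\<^sub>v y)"
    using Q_carrier y Hy by (simp add: mult_add_distrib_mat_vec[of _ n "Suc m"] mult_mat_vec[of _ n "Suc m"])
  then have eb: "b = ?Q *\<^sub>v (?H *\<^sub>v y) + complex_of_real t \<cdot>\<^sub>v (?Q *\<^sub>v y)"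
    unfolding ey start_vec(2) .
  have b1: "b $ l = (?Q *\<^sub>v (?H *\<^sub>v y)) $ l + complex_of_real t * (?Q *\<^sub>v y) $ l" if "l < n" for l
    using arg_cong[OF eb, of "\<lambda>v. v $ l"] that Q_carrier by (simp del: index_mult_mat_vec)
  have b2: "b $ l = (M *\<^sub>v u) $ l + complex_of_real t * u $ l" if "l < n" for l
    using arg_cong[OF eu, of "\<lambda>v. v $ l"] that u by (simp del: index_mult_mat_vec)
  have "M *\<^sub>v shifted_error t = M *\<^sub>v u - (?Q *\<^sub>v (?H *\<^sub>v y) + y $ m \<cdot>\<^sub>v ?w)"
    unfolding shifted_error_def arnoldi_relation[OF M b b0 def y, symmetric] u_def[symmetric] y_def[symmetric]
    by (rule mult_minus_distrib_mat_vec[OF M u Qy])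
  then have eq: "M *\<^sub>v shifted_error t + complex_of_real t \<cdot>\<^sub>v shifted_error t
    = M *\<^sub>v u - (?Q *\<^sub>v (?H *\<^sub>v y) + y $ m \<cdot>\<^sub>v ?w) + complex_of_real t \<cdot>\<^sub>v (u - ?Q *\<^sub>v y)"
    by (simp add: shifted_error_def u_def y_def)
  show ?thesis
  proof (rule eq_vecI)
    fix l assume "l < dim_vec (- (y $ m) \<cdot>\<^sub>v ?w)"
    then have l: "l < n" using w by simp
    then have "(M *\<^sub>v u - (?Q *\<^sub>v (?H *\<^sub>v y) + y $ m \<cdot>\<^sub>v ?w) + complex_of_real t \<cdot>\<^sub>v (u - ?Q *\<^sub>v y)) $ l
      = (M *\<^sub>v u) $ l + complex_of_real t * u $ l - ((?Q *\<^sub>v (?H *\<^sub>v y)) $ l + complex_of_real t * (?Q *\<^sub>v y) $ l)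
        - y $ m * ?w $ l"
      using w u Q_carrier M by (simp add: algebra_simps del: index_mult_mat_vec)
    then show "(M *\<^sub>v shifted_error t + complex_of_real t \<cdot>\<^sub>v shifted_error t) $ l = (- (y $ m) \<cdot>\<^sub>v ?w) $ l"
      unfolding eq using b1[OF l] b2[OF l] l w by (simp del: index_mult_mat_vec)
  qed (use w shifted_error_carrier[OF t] in simp)
qed

text \<open>The product of the last coordinate of \<open>y t\<close> with the determinant of
  \<open>H + t I\<close> does not depend on \<open>t\<close>. Hence the residual at \<open>t\<close>
  is \<open>r\<close> times the residual at \<open>0\<close>, with \<open>r\<close> the quotient of
  the determinants at \<open>0\<close> and \<open>t\<close>, and the contraction property passes
  from residuals to errors.\<close>

lemma shifted_error_le:
  assumes t: "t \<ge> 0"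
  shows "vnorm (shifted_error t) \<le> (\<Prod>i=1..Suc m. cmod (lam i / (lam i + complex_of_real t))) * vnorm (shifted_error 0)"
proof -
  let ?H = "arnoldi_H M b (Suc m)" and ?w = "arnoldi_w M b m"
  define y where "y t = resolvent ?H (complex_of_real t) start_vec" for t
  define D where "D t = (\<Prod>i=1..Suc m. lam i + complex_of_real t)" for t
  have w: "?w \<in> carrier_vec n" by (rule arnoldi_w_carrier[OF M b b0])
  have y: "y t $ m * D t = complex_of_real (vnorm b) * (- 1) ^ m * (\<Prod>i<m. ?H $$ (Suc i, i))" if "t \<ge> 0" for t
  proof -
    let ?S = "shift ?H (complex_of_real t)"
    have yt: "y t \<in> carrier_vec (Suc m)" "?S *\<^sub>v y t = complex_of_real (vnorm b) \<cdot>\<^sub>v unit_vec (Suc m) 0"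
      using resolvents[OF that] shift_mult_vec[OF H_pos_def(1)] by (auto simp: y_def start_vec_def)
    have "y t $ m * det ?S = complex_of_real (vnorm b) * (- 1) ^ m * (\<Prod>i<m. ?S $$ (Suc i, i))"
    proof (rule hessenberg_solution_last[OF shift_carrier[OF H_pos_def(1)] _ yt])
      fix i j assume "i \<le> m" "Suc j < i"
      then show "?S $$ (i, j) = 0"
        by (simp add: shift_index[OF H_pos_def(1)]) (simp add: arnoldi_H_def arnoldi_h_lower)
    qed
    \<comment> \<open>A shift changes the diagonal only, so the subdiagonal product is the same for
      every \<open>t\<close>.\<close>
    also have "(\<Prod>i<m. ?S $$ (Suc i, i)) = (\<Prod>i<m. ?H $$ (Suc i, i))"
      by (intro prod.cong) (auto simp: shift_index[OF H_pos_def(1)])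
    finally show ?thesis by (simp add: D_def det_shift_char_poly[OF H_pos_def(1) cp])
  qed
  have D: "D t \<noteq> 0" using lam_shift_nonzero[OF t] by (simp add: D_def)
  define r where "r = D 0 / D t"
  have "y t $ m * D t = y 0 $ m * D 0" using y[OF t] y[of 0] by simp
  then have yr: "y t $ m = r * y 0 $ m" using D by (simp add: r_def field_simps)
  have e0: "shifted_error 0 \<in> carrier_vec n" and et: "shifted_error t \<in> carrier_vec n"
    using shifted_error_carrier t by auto
  have "M *\<^sub>v shifted_error 0 + complex_of_real 0 \<cdot>\<^sub>v shifted_error 0 = M *\<^sub>v shifted_error 0"
    using M e0 by (intro eq_vecI) (auto simp del: index_mult_mat_vec)
  then have M0: "M *\<^sub>v shifted_error 0 = - (y 0 $ m) \<cdot>\<^sub>v ?w"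
    using shifted_residual[of 0] by (simp add: y_def)
  have "M *\<^sub>v shifted_error t + complex_of_real t \<cdot>\<^sub>v shifted_error t = M *\<^sub>v (r \<cdot>\<^sub>v shifted_error 0)"
    unfolding shifted_residual[OF t] mult_mat_vec[OF M e0] M0
    by (simp add: y_def[symmetric] yr smult_smult_assoc)
  then have "vnorm (shifted_error t) \<le> vnorm (r \<cdot>\<^sub>v shifted_error 0)"
    using e0 by (intro shifted_solution_le[OF M pd et _ t]) auto
  moreover have "cmod r = (\<Prod>i=1..Suc m. cmod (lam i / (lam i + complex_of_real t)))"
    unfolding r_def D_def prod_norm[symmetric] by (simp add: prod_dividef norm_divide prod_norm)
  ultimately show ?thesis by (simp add: vnorm_smult)
qed

section \<open>The Arnoldi error as an integral\<close>

definition error_vec :: "complex vec" where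
  "error_vec = mat_sqrt M *\<^sub>v b - arn_sqrt (Suc m) M b"

lemma error_vec_carrier: "error_vec \<in> carrier_vec n"
  unfolding error_vec_def arn_sqrt_def start_vec(3)
  by (rule minus_carrier_vec) (use mat_sqrt(1)[OF H_pos_def] mat_sqrt(1)[OF M pd] start_vec(1) Q_carrier b in auto)

text \<open>The error serves as its own test vector: the limit is then \<open>pi\<close> times its
  squared norm, and scalar integrals suffice.\<close>

lemma error_integral:
  obtains P where
    "\<And>R. R \<ge> 0 \<Longrightarrow> ((\<lambda>s. complex_of_real (- 2 * s\<^sup>2) * (shifted_error (s\<^sup>2) \<bullet>c error_vec)) has_integral P R) {0..R}"
    "(P \<longlongrightarrow> complex_of_real (pi * (vnorm error_vec)\<^sup>2)) at_top"
proof -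
  let ?Q = "arnoldi_Q M b (Suc m)" and ?H = "arnoldi_H M b (Suc m)"
  define c where "c = error_vec"
  \<comment> \<open>Moving \<open>Q\<close> into the test vector makes the integral formula
    applicable to \<open>H\<close> in its own smaller space.\<close>
  define c' where "c' = mat_adjoint ?Q *\<^sub>v c"
  have c: "c \<in> carrier_vec n" by (simp add: c_def error_vec_carrier)
  have c': "c' \<in> carrier_vec (Suc m)"
    unfolding c'_def using adjoint_carrier_index(1)[OF Q_carrier] c by simp
  note SM = mat_sqrt[OF M pd] and SH = mat_sqrt[OF H_pos_def]
  obtain P1 where P1: "\<And>R. R \<ge> 0 \<Longrightarrow> ((\<lambda>s. 2 * ((M *\<^sub>v resolvent M (complex_of_real (s\<^sup>2)) b) \<bullet>c c)) has_integral P1 R) {0..R}"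
    "(P1 \<longlongrightarrow> complex_of_real pi * ((mat_sqrt M *\<^sub>v b) \<bullet>c c)) at_top"
    using sqrt_integral[OF SM(1,2) M pd SM(3) b c] by blast
  obtain P2 where P2: "\<And>R. R \<ge> 0 \<Longrightarrow> ((\<lambda>s. 2 * ((?H *\<^sub>v resolvent ?H (complex_of_real (s\<^sup>2)) start_vec) \<bullet>c c')) has_integral P2 R) {0..R}"
    "(P2 \<longlongrightarrow> complex_of_real pi * ((mat_sqrt ?H *\<^sub>v start_vec) \<bullet>c c')) at_top"
    using sqrt_integral[OF SH(1,2) H_pos_def SH(3) start_vec(1) c'] by blast
  \<comment> \<open>Both products have the form "start minus \<open>t\<close> times resolvent". As
    \<open>Q\<close> maps \<open>start_vec\<close> to \<open>b\<close>, the terms with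
    \<open>b\<close> cancel and only the difference of the resolvents, the shifted error,
    remains.\<close>
  have integrand: "2 * ((M *\<^sub>v resolvent M (complex_of_real (s\<^sup>2)) b) \<bullet>c c)
      - 2 * ((?H *\<^sub>v resolvent ?H (complex_of_real (s\<^sup>2)) start_vec) \<bullet>c c')
      = complex_of_real (- 2 * s\<^sup>2) * (shifted_error (s\<^sup>2) \<bullet>c c)" for s
  proof -
    define t where "t = complex_of_real (s\<^sup>2)"
    define u where "u = resolvent M t b"
    define y where "y = resolvent ?H t start_vec"
    have u: "u \<in> carrier_vec n" and eu: "M *\<^sub>v u + t \<cdot>\<^sub>v u = b"
      and y: "y \<in> carrier_vec (Suc m)" and ey: "?H *\<^sub>v y + t \<cdot>\<^sub>v y = start_vec"
      using resolvents[of "s\<^sup>2"] unfolding u_def y_def t_def by auto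
    have Hy: "?H *\<^sub>v y \<in> carrier_vec (Suc m)" and Qy: "?Q *\<^sub>v y \<in> carrier_vec n"
      and Mu: "M *\<^sub>v u \<in> carrier_vec n"
      using H_pos_def(1) Q_carrier y M u by auto
    have QHy: "?Q *\<^sub>v (?H *\<^sub>v y) \<in> carrier_vec n" using Q_carrier Hy by simp
    have "(M *\<^sub>v u) \<bullet>c c + t * (u \<bullet>c c) = b \<bullet>c c"
      using Mu u c by (simp add: eu[symmetric] add_scalar_prod_distrib[of _ n])
    moreover have "(?H *\<^sub>v y) \<bullet>c c' + t * ((?Q *\<^sub>v y) \<bullet>c c) = b \<bullet>c c"
    proof -
      have "(?H *\<^sub>v y) \<bullet>c c' = (?Q *\<^sub>v (?H *\<^sub>v y)) \<bullet>c c"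
        using cscalar_prod_adjoint[OF Q_carrier Hy c] by (simp add: c'_def)
      moreover have "?Q *\<^sub>v (?H *\<^sub>v y + t \<cdot>\<^sub>v y) = ?Q *\<^sub>v (?H *\<^sub>v y) + t \<cdot>\<^sub>v (?Q *\<^sub>v y)"
        using Q_carrier y Hy by (simp add: mult_add_distrib_mat_vec[of _ n "Suc m"] mult_mat_vec[of _ n "Suc m"])
      moreover have "(?Q *\<^sub>v (?H *\<^sub>v y) + t \<cdot>\<^sub>v (?Q *\<^sub>v y)) \<bullet>c c
          = (?Q *\<^sub>v (?H *\<^sub>v y)) \<bullet>c c + t * ((?Q *\<^sub>v y) \<bullet>c c)"
        using QHy Qy c by (simp add: add_scalar_prod_distrib[of _ n])
      ultimately show ?thesis unfolding ey start_vec(2) by simp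
    qed
    moreover have "shifted_error (s\<^sup>2) \<bullet>c c = u \<bullet>c c - (?Q *\<^sub>v y) \<bullet>c c"
      unfolding shifted_error_def t_def[symmetric] u_def[symmetric] y_def[symmetric]
      using u Qy c by (simp add: minus_scalar_prod_distrib[of _ n])
    moreover have "complex_of_real (- 2 * s\<^sup>2) = - 2 * t" by (simp add: t_def)
    moreover have "2 * x - 2 * x' = - 2 * t * (z - z')" if "x + t * z = r" "x' + t * z' = r" for x x' z z' r
    proof -
      have "x = r - t * z" "x' = r - t * z'" using that by (auto simp: eq_diff_eq)
      show ?thesis unfolding \<open>x = r - t * z\<close> \<open>x' = r - t * z'\<close> by (simp add: algebra_simps)
    qed
    ultimately have "2 * ((M *\<^sub>v u) \<bullet>c c) - 2 * ((?H *\<^sub>v y) \<bullet>c c') = complex_of_real (- 2 * s\<^sup>2) * (shifted_error (s\<^sup>2) \<bullet>c c)"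
      by metis
    then show ?thesis unfolding u_def y_def t_def .
  qed
  show ?thesis
  proof (rule that[of "\<lambda>R. P1 R - P2 R"])
    fix R :: real assume "R \<ge> 0"
    from has_integral_diff[OF P1(1)[OF this] P2(1)[OF this]]
    show "((\<lambda>s. complex_of_real (- 2 * s\<^sup>2) * (shifted_error (s\<^sup>2) \<bullet>c error_vec)) has_integral P1 R - P2 R) {0..R}"
      unfolding integrand unfolding c_def .
  next
    have Te: "mat_sqrt ?H *\<^sub>v start_vec \<in> carrier_vec (Suc m)" using SH(1) start_vec(1) by simp
    have Sb: "mat_sqrt M *\<^sub>v b \<in> carrier_vec n" using SM(1) b by simp
    have "c \<bullet>c c = (mat_sqrt M *\<^sub>v b) \<bullet>c c - (?Q *\<^sub>v (mat_sqrt ?H *\<^sub>v start_vec)) \<bullet>c c"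
    proof -
      have "c = mat_sqrt M *\<^sub>v b - ?Q *\<^sub>v (mat_sqrt ?H *\<^sub>v start_vec)"
        by (simp add: c_def error_vec_def arn_sqrt_def start_vec(3))
      then have "c \<bullet>c c = (mat_sqrt M *\<^sub>v b - ?Q *\<^sub>v (mat_sqrt ?H *\<^sub>v start_vec)) \<bullet>c c" by simp
      also have "\<dots> = (mat_sqrt M *\<^sub>v b) \<bullet>c c - (?Q *\<^sub>v (mat_sqrt ?H *\<^sub>v start_vec)) \<bullet>c c"
        by (rule minus_scalar_prod_distrib[of _ n]) (use Sb Q_carrier Te c in auto)
      finally show ?thesis .
    qed
    moreover have "(?Q *\<^sub>v (mat_sqrt ?H *\<^sub>v start_vec)) \<bullet>c c = (mat_sqrt ?H *\<^sub>v start_vec) \<bullet>c c'"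
      unfolding c'_def by (rule cscalar_prod_adjoint[OF Q_carrier Te c])
    ultimately have "complex_of_real (pi * (vnorm c)\<^sup>2) = complex_of_real pi * ((mat_sqrt M *\<^sub>v b) \<bullet>c c)
        - complex_of_real pi * ((mat_sqrt ?H *\<^sub>v start_vec) \<bullet>c c')"
      unfolding of_real_mult cscalar_prod_self[OF c, symmetric] by (simp only: right_diff_distrib)
    then show "((\<lambda>R. P1 R - P2 R) \<longlongrightarrow> complex_of_real (pi * (vnorm error_vec)\<^sup>2)) at_top"
      using tendsto_diff[OF P1(2) P2(2)] by (simp add: c_def)
  qed
qed

section \<open>Truncated integrals and passage to the limit\<close>

definition damping :: "real \<Rightarrow> real" where
  "damping x = (\<Prod>i=1..Suc m. cmod (lam i / (lam i + complex_of_real x)))"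

lemma damping_nonneg: "damping x \<ge> 0"
  unfolding damping_def by (intro prod_nonneg) auto

lemma continuous_on_damping: "continuous_on {0..} damping"
  unfolding damping_def by (intro continuous_intros) (use lam_shift_nonzero in auto)

text \<open>Substituting \<open>x = s^2\<close> turns \<open>2 s^2 ds\<close> into
  \<open>sqrt x dx\<close>; the inequality comes from enlarging the range \<open>{0..R^2}\<close> to
  the half-line. The left-hand side is finite even if the full integral diverges.\<close>

lemma truncated_integral_le:
  assumes R: "R \<ge> 0"
  shows "ennreal (integral {0..R} (\<lambda>s. 2 * s\<^sup>2 * damping (s\<^sup>2)))
    \<le> (\<integral>\<^sup>+ x\<in>{0..}. ennreal (sqrt x * damping x) \<partial>lborel)"
proof -
  have cont: "continuous_on {0..R} (\<lambda>s. 2 * s\<^sup>2 * damping (s\<^sup>2))"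
    by (intro continuous_intros continuous_on_compose2[OF continuous_on_damping]) auto
  have "ennreal (integral {0..R} (\<lambda>s. 2 * s\<^sup>2 * damping (s\<^sup>2)))
    = (\<integral>\<^sup>+ s. ennreal (indicator {0..R} s * (2 * s\<^sup>2 * damping (s\<^sup>2))) \<partial>lborel)"
    using integrable_integral[OF integrable_continuous_interval[OF cont]] damping_nonneg
    by (intro nn_integral_has_integral_lebesgue[symmetric]) auto
  also have "\<dots> = (\<integral>\<^sup>+ s. ennreal (sqrt (s\<^sup>2) * damping (s\<^sup>2) * (2 * s) * indicator {0..R} s) \<partial>lborel)"
    by (intro nn_integral_cong) (auto simp: indicator_def power2_eq_square mult_ac)
  also have "\<dots> = (\<integral>\<^sup>+ x. ennreal (sqrt x * damping x * indicator {0\<^sup>2..R\<^sup>2} x) \<partial>lborel)"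
  proof (rule nn_integral_substitution[symmetric, where g = "\<lambda>s. s\<^sup>2" and g' = "\<lambda>s. 2 * s"])
    have "continuous_on {0\<^sup>2..R\<^sup>2} (\<lambda>x. sqrt x * damping x)"
      by (intro continuous_intros continuous_on_subset[OF continuous_on_damping]) auto
    then show "set_borel_measurable borel {0\<^sup>2..R\<^sup>2} (\<lambda>x. sqrt x * damping x)"
      by (intro borel_measurable_continuous_on_indicator[folded set_borel_measurable_def]) auto
  qed (use R in \<open>auto intro!: derivative_eq_intros continuous_intros\<close>)
  also have "\<dots> \<le> (\<integral>\<^sup>+ x\<in>{0..}. ennreal (sqrt x * damping x) \<partial>lborel)"
    by (intro nn_integral_mono) (auto simp: indicator_def)
  finally show ?thesis .
qed

text \<open>Bounding the integrand by \<open>shifted_error_le\<close> and Cauchy--Schwarz gives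
  \<open>|P R| \<le> B |e|\<close> for the error \<open>e\<close>; the limit gives
  \<open>pi |e|^2 \<le> B |e|\<close>, and one factor cancels. Stating the hypothesis for truncated
  integrals times the norm of the initial error keeps everything real and lets \<open>B = 0\<close>
  cover a vanishing initial error.\<close>

lemma error_vec_bound:
  assumes B: "\<And>R. R \<ge> 0 \<Longrightarrow> integral {0..R} (\<lambda>s. 2 * s\<^sup>2 * damping (s\<^sup>2)) * vnorm (shifted_error 0) \<le> B"
  shows "pi * vnorm error_vec \<le> B"
proof (cases "vnorm error_vec = 0")
  case True
  \<comment> \<open>The truncated integral over \<open>{0..0}\<close> is zero, which gives
    \<open>B \<ge> 0\<close>.\<close>
  then show ?thesis using B[of 0] by simp
next
  case False
  then have pos: "vnorm error_vec > 0" by (simp add: order_less_le)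
  obtain P where P: "\<And>R. R \<ge> 0 \<Longrightarrow> ((\<lambda>s. complex_of_real (- 2 * s\<^sup>2) * (shifted_error (s\<^sup>2) \<bullet>c error_vec)) has_integral P R) {0..R}"
    "(P \<longlongrightarrow> complex_of_real (pi * (vnorm error_vec)\<^sup>2)) at_top"
    using error_integral by blast
  have "cmod (P R) \<le> B * vnorm error_vec" if R: "R \<ge> 0" for R
  proof -
    let ?k = "\<lambda>s. 2 * s\<^sup>2 * damping (s\<^sup>2)"
    have cont: "continuous_on {0..R} ?k"
      by (intro continuous_intros continuous_on_compose2[OF continuous_on_damping]) auto
    have I: "(?k has_integral integral {0..R} ?k) {0..R}"
      using integrable_continuous_interval[OF cont] by (rule integrable_integral)
    have "cmod (complex_of_real (- 2 * s\<^sup>2) * (shifted_error (s\<^sup>2) \<bullet>c error_vec))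
      \<le> ?k s * (vnorm (shifted_error 0) * vnorm error_vec)" for s
    proof -
      have "cmod (shifted_error (s\<^sup>2) \<bullet>c error_vec) \<le> vnorm (shifted_error (s\<^sup>2)) * vnorm error_vec"
        by (rule cscalar_prod_le[OF shifted_error_carrier error_vec_carrier]) simp
      also have "\<dots> \<le> damping (s\<^sup>2) * vnorm (shifted_error 0) * vnorm error_vec"
        using shifted_error_le[of "s\<^sup>2"] unfolding damping_def by (intro mult_right_mono) auto
      finally have "2 * s\<^sup>2 * cmod (shifted_error (s\<^sup>2) \<bullet>c error_vec)
        \<le> 2 * s\<^sup>2 * (damping (s\<^sup>2) * vnorm (shifted_error 0) * vnorm error_vec)"
        by (rule mult_left_mono) simp
      then show ?thesis by (simp add: norm_mult norm_power mult_ac)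
    qed
    then have "cmod (integral {0..R} (\<lambda>s. complex_of_real (- 2 * s\<^sup>2) * (shifted_error (s\<^sup>2) \<bullet>c error_vec)))
      \<le> integral {0..R} (\<lambda>s. ?k s * (vnorm (shifted_error 0) * vnorm error_vec))"
      using P(1)[OF R] has_integral_mult_left[OF I]
      by (intro integral_norm_bound_integral) (blast intro: has_integral_integrable)+
    also have "\<dots> = integral {0..R} ?k * vnorm (shifted_error 0) * vnorm error_vec"
      by simp
    also have "\<dots> \<le> B * vnorm error_vec" using B[OF R] by (intro mult_right_mono) auto
    finally show ?thesis unfolding integral_unique[OF P(1)[OF R]] .
  qed
  then have "eventually (\<lambda>R. cmod (P R) \<le> B * vnorm error_vec) at_top"
    using eventually_ge_at_top[of 0] by (rule eventually_mono[rotated]) 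
  then have "cmod (complex_of_real (pi * (vnorm error_vec)\<^sup>2)) \<le> B * vnorm error_vec"
    by (intro tendsto_upperbound[OF tendsto_norm[OF P(2)]]) auto
  then have "(pi * vnorm error_vec) * vnorm error_vec \<le> B * vnorm error_vec"
    by (simp only: norm_of_real) (simp add: power2_eq_square abs_mult mult_ac)
  then show ?thesis using pos by (simp only: mult_le_cancel_right_pos)
qed

text \<open>The passage to values in \<open>[0, \<infinity>]\<close>. A finite integral
  \<open>r\<close> gives the real bound \<open>B = r |e0|\<close>, where \<open>e0\<close> is the
  error at shift \<open>0\<close>; an infinite integral with nonzero \<open>e0\<close> makes the
  right-hand side infinite.\<close>

lemma arnoldi_sqrt_error_bound:
  "ennreal (vnorm (mat_sqrt M *\<^sub>v b - arn_sqrt (Suc m) M b))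
     \<le> ennreal (1 / pi)
        * (\<integral>\<^sup>+ x\<in>{0..}. ennreal (sqrt x * (\<Prod>i=1..Suc m. cmod (lam i / (lam i + complex_of_real x)))) \<partial>lborel)
        * ennreal (vnorm (fom_error (Suc m) M b))"
  unfolding fom_error_eq error_vec_def[symmetric] damping_def[symmetric]
proof -
  define I where "I = (\<integral>\<^sup>+ x\<in>{0..}. ennreal (sqrt x * damping x) \<partial>lborel)"
  have le_I: "ennreal (integral {0..R} (\<lambda>s. 2 * s\<^sup>2 * damping (s\<^sup>2))) \<le> I" if "R \<ge> 0" for R
    unfolding I_def by (rule truncated_integral_le[OF that])
  show "ennreal (vnorm error_vec) \<le> ennreal (1 / pi) * I * ennreal (vnorm (shifted_error 0))"
  proof (cases "vnorm (shifted_error 0) = 0")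
    case True
    \<comment> \<open>Here the right-hand side is zero even for a divergent integral, so the Arnoldi
      approximation must be shown to be exact; \<open>B = 0\<close> does this.\<close>
    then have "pi * vnorm error_vec \<le> 0" by (intro error_vec_bound) simp
    then have "vnorm error_vec \<le> 0" using pi_gt_zero by (meson mult_pos_pos not_le)
    then have "vnorm error_vec = 0" using vnorm_nonneg[of error_vec] by linarith
    then show ?thesis by simp
  next
    case False
    show ?thesis
    proof (cases I)
      case (real r)
      have "pi * vnorm error_vec \<le> r * vnorm (shifted_error 0)"
      proof (rule error_vec_bound)
        fix R :: real assume "R \<ge> 0"
        then show "integral {0..R} (\<lambda>s. 2 * s\<^sup>2 * damping (s\<^sup>2)) * vnorm (shifted_error 0) \<le> r * vnorm (shifted_error 0)"
          using le_I[of R] real by (intro mult_right_mono) auto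
      qed
      then have "vnorm error_vec \<le> 1 / pi * r * vnorm (shifted_error 0)"
        by (simp add: field_simps)
      then show ?thesis
        using real by (simp add: ennreal_mult'[symmetric] ennreal_leI)
    next
      case top
      then show ?thesis using False by (simp add: ennreal_mult_top ennreal_top_mult order_less_le)
    qed
  qed
qed

end

theorem theorem3p5:
  fixes M :: "complex mat" and b :: "complex vec" and n k :: nat
    and lam :: "nat \<Rightarrow> complex"
  assumes "M \<in> carrier_mat n n"
    and "pos_def M"
    and "b \<in> carrier_vec n"
    and "b \<noteq> 0\<^sub>v n"
    and "k \<ge> 1"
    and "arnoldi_defined M b k"
    and "char_poly (arnoldi_H M b k) = (\<Prod>i=1..k. [:- lam i, 1:])"
  shows "ennreal (vnorm (mat_sqrt M *\<^sub>v b - arn_sqrt k M b))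
     \<le> ennreal (1 / pi)
        * (\<integral>\<^sup>+ x\<in>{0..}. ennreal (sqrt x * (\<Prod>i=1..k. cmod (lam i / (lam i + complex_of_real x)))) \<partial>lborel)
        * ennreal (vnorm (fom_error k M b))"
proof -
  obtain m where k: "k = Suc m" using assms(5) by (cases k) auto
  show ?thesis
    using arnoldi_sqrt_error_bound[OF assms(1-4) assms(6,7)[unfolded k]] unfolding k .
qed

end
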